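(* Every $K_\infty$-biinvariant continuous function $\psi$ of negative type on $G_\infty=SL(\infty)$, where $K_\infty=SU(\infty)$, is bounded and can be uniquely written as $$\psi(g)=\psi(e)+\varphi(e)-\varphi(g)\qquad(g\in G_\infty),$$ where $\varphi$ is a function of positive type relatively to the spherical pair $(G_\infty,K_\infty)$.
   Context: **Groups.** For $n\ge1$ let $G_n=SL(n,\mathbb C)$ and $K_n=SU(n)$, embedded in $G_{n+1}$ and $K_{n+1}$ by $g\mapsto \mathrm{diag}(g,1)$. $G_\infty=SL(\infty)=\bigcup_n G_n$ is the group of infinite invertible complex matrices $(g_{ij})_{i,j\ge1}$ of determinant $1$ with only finitely many entries $g_{ij}\ne\delta_{ij}$, equipped with the inductive limit topology. $K_\infty=SU(\infty)=\bigcup_n K_n$ is the closed subgroup of unitary matrices of determinant $1$ in $G_\infty$. $(G_\infty,K_\infty)$ is the Olshanski spherical pair obtained as the inductive limit of the Gelfand pairs $(G_n,K_n)$. The identity element of $G_\infty$ is denoted $e$. **Biinvariance.** A function $f$ on $G_\infty$ is $K_\infty$-biinvariant if $f(k_1gk_2)=f(g)$ for all $k_1,k_2\in K_\infty$ and $g\in G_\infty$. **Positive type.** A function $\varphi:G_\infty\to\mathbb C$ is of positive type if $\sum_{i,j=1}^n c_i\overline{c_j}\,\varphi(g_j^{-1}g_i)\ge0$ for all $n$, all $g_1,\dots,g_n\in G_\infty$ and all $c_1,\dots,c_n\in\mathbb C$. A function of positive type relatively to the spherical pair $(G_\infty,K_\infty)$ means a $K_\infty$-biinvariant continuous function of positive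 type on $G_\infty$. **Negative type.** A function $\psi:G_\infty\to\mathbb C$ is of negative type if $\psi(e)\ge0$, $\psi(g^{-1})=\overline{\psi(g)}$ for all $g\in G_\infty$, and $\sum_{i,j=1}^N c_i\overline{c_j}\,\psi(g_j^{-1}g_i)\le0$ for all $N$, all $g_1,\dots,g_N\in G_\infty$ and all $c_1,\dots,c_N\in\mathbb C$ with $\sum_{i=1}^N c_i=0$.
   Formalization: Literal uniqueness of φ fails, since φ + c with any constant c ≥ 0 gives the same ψ; it is replaced by uniqueness of φ up to an additive real constant, and by exact uniqueness among those φ from which no positive constant can be subtracted while staying of positive type. *)

theory Defs
  imports
    "HOL-Algebra.Coset"
    "HOL-Analysis.Elementary_Metric_Spaces"
    "HOL-Analysis.Function_Topology"
    "HOL-Library.Nonpos_Ints"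
    "Jordan_Normal_Form.Schur_Decomposition"
begin

text \<open>
  An infinite matrix is a function \<open>nat \<Rightarrow> nat \<Rightarrow> complex\<close>, with rows and columns indexed from 0.
  \<open>SL n\<close> is the copy of SL(n,C) inside the infinite matrices, g being identified with
  diag(g,1,1,...). \<open>SL 0\<close> and \<open>SL 1\<close> both consist of the identity only, so letting n start
  from 0 instead of 1 does not affect unions over n.
\<close>

type_synonym infmat = "nat \<Rightarrow> nat \<Rightarrow> complex"

definition block :: "nat \<Rightarrow> infmat \<Rightarrow> complex mat" where
  "block n g = mat n n (\<lambda>(i, j). g i j)"

definition SL :: "nat \<Rightarrow> infmat set" where
  "SL n = {g. (\<forall>i j. n \<le> i \<or> n \<le> j \<longrightarrow> g i j = of_bool (i = j)) \<and> det (block n g) = 1}"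

definition SU :: "nat \<Rightarrow> infmat set" where
  "SU n = {g \<in> SL n. mat_adjoint (block n g) * block n g = 1\<^sub>m n}"

text \<open>
  The sum in the product below ranges over the nonzero entries of the i-th row of g, which is a
  finite set for every g in the carrier.
\<close>

definition SL_inf :: "infmat monoid" where
  "SL_inf = \<lparr>carrier = (\<Union>n. SL n),
             monoid.mult = (\<lambda>g h i j. \<Sum>k | g i k \<noteq> 0. g i k * h k j),
             one = (\<lambda>i j. of_bool (i = j))\<rparr>"

definition SU_inf :: "infmat set" where
  "SU_inf = (\<Union>n. SU n)"

text \<open>
  The inductive limit topology. The type \<open>infmat\<close> carries the topology of entrywise
  convergence, which induces on \<open>SL n\<close> the usual topology as a subset of the n-by-n matrices.
\<close>

definition SL_inf_topology :: "infmat topology" where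
  "SL_inf_topology =
     topology (\<lambda>U. U \<subseteq> carrier SL_inf \<and> (\<forall>n. openin (top_of_set (SL n)) (U \<inter> SL n)))"

definition biinvariant :: "('a, 'b) monoid_scheme \<Rightarrow> 'a set \<Rightarrow> ('a \<Rightarrow> complex) \<Rightarrow> bool" where
  "biinvariant G K f \<longleftrightarrow>
     (\<forall>k1\<in>K. \<forall>k2\<in>K. \<forall>g\<in>carrier G. f (k1 \<otimes>\<^bsub>G\<^esub> g \<otimes>\<^bsub>G\<^esub> k2) = f g)"

definition positive_type :: "('a, 'b) monoid_scheme \<Rightarrow> ('a \<Rightarrow> complex) \<Rightarrow> bool" where
  "positive_type G \<phi> \<longleftrightarrow>
     (\<forall>(n::nat) (g :: nat \<Rightarrow> 'a) (c :: nat \<Rightarrow> complex). (\<forall>i<n. g i \<in> carrier G) \<longrightarrow>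
        (\<Sum>i<n. \<Sum>j<n. c i * cnj (c j) * \<phi> (inv\<^bsub>G\<^esub> (g j) \<otimes>\<^bsub>G\<^esub> g i)) \<in> \<real>\<^sub>\<ge>\<^sub>0)"

definition negative_type :: "('a, 'b) monoid_scheme \<Rightarrow> ('a \<Rightarrow> complex) \<Rightarrow> bool" where
  "negative_type G \<psi> \<longleftrightarrow>
     \<psi> \<one>\<^bsub>G\<^esub> \<in> \<real>\<^sub>\<ge>\<^sub>0 \<and>
     (\<forall>g\<in>carrier G. \<psi> (inv\<^bsub>G\<^esub> g) = cnj (\<psi> g)) \<and>
     (\<forall>(n::nat) (g :: nat \<Rightarrow> 'a) (c :: nat \<Rightarrow> complex).
        (\<forall>i<n. g i \<in> carrier G) \<longrightarrow> (\<Sum>i<n. c i) = 0 \<longrightarrow>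
        (\<Sum>i<n. \<Sum>j<n. c i * cnj (c j) * \<psi> (inv\<^bsub>G\<^esub> (g j) \<otimes>\<^bsub>G\<^esub> g i)) \<in> \<real>\<^sub>\<le>\<^sub>0)"

definition spherical_positive_type :: "(infmat \<Rightarrow> complex) \<Rightarrow> bool" where
  "spherical_positive_type \<phi> \<longleftrightarrow>
     biinvariant SL_inf SU_inf \<phi> \<and> continuous_map SL_inf_topology euclidean \<phi> \<and>
     positive_type SL_inf \<phi>"

definition represents :: "(infmat \<Rightarrow> complex) \<Rightarrow> (infmat \<Rightarrow> complex) \<Rightarrow> bool" where
  "represents \<phi> \<psi> \<longleftrightarrow>
     spherical_positive_type \<phi> \<and>
     (\<forall>g\<in>carrier SL_inf. \<psi> g = \<psi> \<one>\<^bsub>SL_inf\<^esub> + \<phi> \<one>\<^bsub>SL_inf\<^esub> - \<phi> g)"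

text \<open>
  If \<phi> represents \<psi>, so does \<phi> + c for every real c \<ge> 0, since nonnegative constants are of
  positive type and cancel in the formula. The representing function becomes unique once it is
  reduced, i.e. no positive constant can be split off (its decomposition into spherical functions
  of positive type does not charge the trivial one).
\<close>

definition reduced :: "(infmat \<Rightarrow> complex) \<Rightarrow> bool" where
  "reduced \<phi> \<longleftrightarrow> (\<forall>c::real. c > 0 \<longrightarrow> \<not> spherical_positive_type (\<lambda>g. \<phi> g - complex_of_real c))"


lemma SL_inf_simps [simp]:
  "carrier SL_inf = (\<Union>n. SL n)"
  "g \<otimes>\<^bsub>SL_inf\<^esub> h = (\<lambda>i j. \<Sum>k | g i k \<noteq> 0. g i k * h k j)"
  "\<one>\<^bsub>SL_inf\<^esub> = (\<lambda>i j. of_bool (i = j))"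
  by (simp_all add: SL_inf_def)

lemma openin_SL_inf_topology:
  "openin SL_inf_topology U \<longleftrightarrow>
     U \<subseteq> carrier SL_inf \<and> (\<forall>n. openin (top_of_set (SL n)) (U \<inter> SL n))"
proof -
  have "istopology (\<lambda>U. U \<subseteq> carrier SL_inf \<and> (\<forall>n. openin (top_of_set (SL n)) (U \<inter> SL n)))"
    unfolding istopology_def
  proof (intro conjI allI impI)
    fix S T n
    assume "S \<subseteq> carrier SL_inf \<and> (\<forall>n. openin (top_of_set (SL n)) (S \<inter> SL n))"
      and "T \<subseteq> carrier SL_inf \<and> (\<forall>n. openin (top_of_set (SL n)) (T \<inter> SL n))"
    then have "openin (top_of_set (SL n)) ((S \<inter> SL n) \<inter> (T \<inter> SL n))"
      by blast
    then show "openin (top_of_set (SL n)) (S \<inter> T \<inter> SL n)"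
      by (simp add: Int_ac)
  next
    fix \<K> n
    assume "\<forall>K\<in>\<K>. K \<subseteq> carrier SL_inf \<and> (\<forall>n. openin (top_of_set (SL n)) (K \<inter> SL n))"
    then have "openin (top_of_set (SL n)) (\<Union>K\<in>\<K>. K \<inter> SL n)"
      by blast
    then show "openin (top_of_set (SL n)) (\<Union>\<K> \<inter> SL n)"
      by (simp only: Int_Union2)
  qed auto
  then show ?thesis
    unfolding SL_inf_topology_def by (simp add: topology_inverse')
qed

lemma topspace_SL_inf_topology: "topspace SL_inf_topology = carrier SL_inf"
proof
  show "topspace SL_inf_topology \<subseteq> carrier SL_inf"
    unfolding topspace_def using openin_SL_inf_topology by blast
  have "carrier SL_inf \<inter> SL n = SL n" for n by auto
  then have "openin SL_inf_topology (carrier SL_inf)"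
    unfolding openin_SL_inf_topology by simp
  then show "carrier SL_inf \<subseteq> topspace SL_inf_topology"
    by (rule openin_subset)
qed

lemma block_carrier [simp]: "block n g \<in> carrier_mat n n"
  "dim_row (block n g) = n" "dim_col (block n g) = n"
  by (simp_all add: block_def)

lemma SL_I:
  "\<lbrakk>\<And>i j. n \<le> i \<or> n \<le> j \<Longrightarrow> g i j = of_bool (i = j); det (block n g) = 1\<rbrakk> \<Longrightarrow> g \<in> SL n"
  by (simp add: SL_def)

lemma SL_outside: "g \<in> SL n \<Longrightarrow> n \<le> i \<or> n \<le> j \<Longrightarrow> g i j = of_bool (i = j)"
  unfolding SL_def by blast

lemma SL_det: "g \<in> SL n \<Longrightarrow> det (block n g) = 1"
  by (simp add: SL_def)

lemma SL_Suc: "SL n \<subseteq> SL (Suc n)"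
proof
  fix g assume g: "g \<in> SL n"
  have eq: "block (Suc n) g = four_block_mat (block n g) (0\<^sub>m n 1) (0\<^sub>m 1 n) (1\<^sub>m 1)"
    by (rule eq_matI) (auto simp: block_def SL_outside[OF g] four_block_mat_def less_Suc_eq)
  have "det (block (Suc n) g) = det (block n g) * det (1\<^sub>m 1 :: complex mat)"
    unfolding eq by (rule det_four_block_mat_upper_right_zero) auto
  then show "g \<in> SL (Suc n)"
    using g by (auto intro!: SL_I simp: SL_outside[OF g] SL_det[OF g])
qed

lemma SL_mono: "m \<le> n \<Longrightarrow> SL m \<subseteq> SL n"
  by (rule lift_Suc_mono_le[of SL]) (rule SL_Suc)

lemma SL_mult_eq:
  assumes g: "g \<in> SL n"
  shows "(g \<otimes>\<^bsub>SL_inf\<^esub> h) i j = (if i < n then \<Sum>k<n. g i k * h k j else h i j)"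
proof (cases "i < n")
  case True
  have "{k. g i k \<noteq> 0} \<subseteq> {..<n}"
    using True SL_outside[OF g, of i] by (auto simp: not_less[symmetric])
  then have "(\<Sum>k | g i k \<noteq> 0. g i k * h k j) = (\<Sum>k<n. g i k * h k j)"
    by (intro sum.mono_neutral_left) auto
  with True show ?thesis by simp
next
  case False
  then have "g i k = of_bool (i = k)" for k using SL_outside[OF g, of i k] by simp
  with False show ?thesis by simp
qed

lemma block_mult:
  assumes g: "g \<in> SL n"
  shows "block n (g \<otimes>\<^bsub>SL_inf\<^esub> h) = block n g * block n h"
  by (rule eq_matI)
     (simp_all add: SL_mult_eq[OF g] block_def scalar_prod_def atLeast0LessThan
       del: SL_inf_simps)

lemma SL_mult_closed:
  assumes g: "g \<in> SL n" and h: "h \<in> SL n"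
  shows "g \<otimes>\<^bsub>SL_inf\<^esub> h \<in> SL n"
proof (rule SL_I)
  fix i j assume "n \<le> i \<or> n \<le> j"
  then show "(g \<otimes>\<^bsub>SL_inf\<^esub> h) i j = of_bool (i = j)"
    using SL_outside[OF h, of _ j] SL_outside[OF h, of i j]
    by (auto simp: SL_mult_eq[OF g] simp del: SL_inf_simps)
qed (simp add: block_mult[OF g] det_mult[of _ n] SL_det[OF g] SL_det[OF h] del: SL_inf_simps)

lemma SL_eqI:
  assumes "g \<in> SL n" "h \<in> SL n" "block n g = block n h"
  shows "g = h"
proof (intro ext)
  fix i j
  show "g i j = h i j"
  proof (cases "i < n \<and> j < n")
    case True
    then show ?thesis
      using arg_cong[OF assms(3), of "\<lambda>M. M $$ (i, j)"] by (simp add: block_def)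
  next
    case False
    then show ?thesis
      using SL_outside[OF assms(1), of i j] SL_outside[OF assms(2), of i j] by auto
  qed
qed

lemma block_one: "block n \<one>\<^bsub>SL_inf\<^esub> = 1\<^sub>m n"
  by (rule eq_matI) (simp_all add: block_def)

lemma SL_one: "\<one>\<^bsub>SL_inf\<^esub> \<in> SL n"
  by (rule SL_I) (use block_one in simp_all)

lemma SL_common:
  assumes "g \<in> carrier SL_inf" "h \<in> carrier SL_inf"
  obtains n where "g \<in> SL n" "h \<in> SL n"
proof -
  obtain m n where "g \<in> SL m" "h \<in> SL n" using assms by auto
  then have "g \<in> SL (max m n)" "h \<in> SL (max m n)"
    using SL_mono[of m "max m n"] SL_mono[of n "max m n"] by auto
  then show thesis by (rule that)
qed

lemma SL_extend:
  assumes B: "B \<in> carrier_mat n n" and "det B = 1"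
  obtains h where "h \<in> SL n" "block n h = B"
proof
  let ?h = "\<lambda>i j. if i < n \<and> j < n then B $$ (i, j) else of_bool (i = j)"
  show *: "block n ?h = B"
    using B by (intro eq_matI) (auto simp: block_def)
  show "?h \<in> SL n"
    by (rule SL_I) (use * assms in auto)
qed

lemma SL_left_inverse:
  assumes g: "g \<in> SL n"
  obtains h where "h \<in> SL n" "h \<otimes>\<^bsub>SL_inf\<^esub> g = \<one>\<^bsub>SL_inf\<^esub>" "block n h * block n g = 1\<^sub>m n"
proof -
  have "block n g \<in> Units (ring_mat TYPE(complex) n ())"
    using SL_det[OF g] by (intro det_non_zero_imp_unit) auto
  then obtain B where B: "B \<in> carrier_mat n n" "B * block n g = 1\<^sub>m n"
    unfolding Units_def ring_mat_def by auto
  then have "det B = 1"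
    using det_mult[of B n "block n g"] SL_det[OF g] by simp
  then obtain h where h: "h \<in> SL n" "block n h = B" using SL_extend B(1) by blast
  have "h \<otimes>\<^bsub>SL_inf\<^esub> g = \<one>\<^bsub>SL_inf\<^esub>"
    by (rule SL_eqI[OF SL_mult_closed[OF h(1) g] SL_one])
       (simp add: block_mult[OF h(1)] h(2) B(2) block_one del: SL_inf_simps)
  with h B(2) show thesis by (intro that) auto
qed

lemma group_SL_inf: "group SL_inf"
proof (rule groupI)
  fix x y assume "x \<in> carrier SL_inf" "y \<in> carrier SL_inf"
  then obtain n where "x \<in> SL n" "y \<in> SL n" by (rule SL_common)
  then have "x \<otimes>\<^bsub>SL_inf\<^esub> y \<in> SL n" by (rule SL_mult_closed)
  then show "x \<otimes>\<^bsub>SL_inf\<^esub> y \<in> carrier SL_inf" by (subst SL_inf_simps(1)) blast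
next
  show "\<one>\<^bsub>SL_inf\<^esub> \<in> carrier SL_inf"
    using SL_one by (subst SL_inf_simps(1)) blast
next
  fix x y z assume *: "x \<in> carrier SL_inf" "y \<in> carrier SL_inf" "z \<in> carrier SL_inf"
  obtain m where m: "x \<in> SL m" "y \<in> SL m" using *(1,2) by (rule SL_common)
  obtain k where k: "z \<in> SL k" using *(3) by auto
  define n where "n = max m k"
  have n: "x \<in> SL n" "y \<in> SL n" "z \<in> SL n"
    using m k SL_mono[of m n] SL_mono[of k n] by (auto simp: n_def)
  note closed = SL_mult_closed
  show "x \<otimes>\<^bsub>SL_inf\<^esub> y \<otimes>\<^bsub>SL_inf\<^esub> z = x \<otimes>\<^bsub>SL_inf\<^esub> (y \<otimes>\<^bsub>SL_inf\<^esub> z)"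
    by (rule SL_eqI[OF closed[OF closed[OF n(1,2)] n(3)] closed[OF n(1) closed[OF n(2,3)]]])
       (simp add: block_mult[OF closed[OF n(1,2)]] block_mult[OF n(1)] block_mult[OF n(2)]
         assoc_mult_mat[of _ n n _ n _ n] del: SL_inf_simps)
next
  fix x assume "x \<in> carrier SL_inf"
  then obtain n where n: "x \<in> SL n" by auto
  show "\<one>\<^bsub>SL_inf\<^esub> \<otimes>\<^bsub>SL_inf\<^esub> x = x"
    by (rule SL_eqI[OF SL_mult_closed[OF SL_one n] n])
       (simp add: block_mult[OF SL_one] block_one left_mult_one_mat[of _ n n] del: SL_inf_simps)
  obtain h where "h \<in> SL n" "h \<otimes>\<^bsub>SL_inf\<^esub> x = \<one>\<^bsub>SL_inf\<^esub>" using n by (rule SL_left_inverse)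
  then show "\<exists>y\<in>carrier SL_inf. y \<otimes>\<^bsub>SL_inf\<^esub> x = \<one>\<^bsub>SL_inf\<^esub>"
    by (subst SL_inf_simps(1)) blast
qed

end

theory Submission
  imports Defs "HOL-Analysis.Complex_Analysis_Basics"
begin

text \<open>
  Let \<open>T p s\<close> be the transvection with entry \<open>s\<close> in row \<open>p\<close> and column 0. By invariance under
  rotations, the value of \<open>\<psi>\<close> at the product of \<open>g\<close> and of shears \<open>T p s\<close> in rows not involved in
  \<open>g\<close> depends only on \<open>g\<close> and on the sum \<open>t\<close> of the squares \<open>s\<^sup>2\<close>; call it \<open>\<psi>\<^sub>t g\<close>. If \<open>g\<close> ranges over
  elements commuting with these shears, then \<open>\<psi>\<^sub>t - \<psi>\<close> is of positive type, because \<open>g\<close> and \<open>g T p s\<close>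
  may be used with opposite coefficients. Hence it suffices to show that \<open>\<psi>\<^sub>t g\<close> tends, as \<open>t\<close> goes
  to infinity, to a limit \<open>L\<close> not depending on \<open>g\<close>: then \<open>L - \<psi>\<close> is of positive type, hence bounded.

  For \<open>g = 1\<close> the function \<open>\<psi>\<^sub>t 1\<close> of \<open>t\<close> is nondecreasing with decreasing increments. It is bounded
  by a scaling argument in the spirit of relative property (T): conjugation by a diagonal matrix
  \<open>a\<close> rescales the shears, so on each scale the mass of \<open>\<psi>\<close> is controlled by the part of \<open>\<psi> a\<close>
  living on that scale, and these parts add up to at most a constant. For general \<open>g\<close> the limit
  is the same by Mautner's argument: the elements asymptotically fixing the far shears form a
  subgroup which contains all transvections.
\<close>

section \<open>Transvections, rotations and dilations\<close>

declare SL_inf_simps [simp del]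

interpretation SLinf: group SL_inf
  by (rule group_SL_inf)

abbreviation inf_mult :: "infmat \<Rightarrow> infmat \<Rightarrow> infmat" (infixl "\<cdot>" 70)
  where "g \<cdot> h \<equiv> g \<otimes>\<^bsub>SL_inf\<^esub> h"

lemma SL_inf_memI: "g \<in> SL n \<Longrightarrow> g \<in> carrier SL_inf"
  by (auto simp: SL_inf_simps(1))

lemma SL_inf_memE:
  assumes "g \<in> carrier SL_inf"
  obtains n where "n > 0" "g \<in> SL n"
  using assms SL_Suc by (auto simp: SL_inf_simps(1))

lemma inf_mult_left:
  assumes "finite S" "\<And>k. k \<notin> S \<Longrightarrow> g i k = 0"
  shows "(g \<cdot> h) i j = (\<Sum>k\<in>S. g i k * h k j)"
  unfolding SL_inf_simps using assms by (intro sum.mono_neutral_left) auto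

definition transvection :: "nat \<Rightarrow> nat \<Rightarrow> complex \<Rightarrow> infmat" where
  "transvection p q z = (\<lambda>i j. of_bool (i = j) + (if i = p \<and> j = q then z else 0))"

definition rotation :: "nat \<Rightarrow> nat \<Rightarrow> real \<Rightarrow> real \<Rightarrow> infmat" where
  "rotation p r c s = (\<lambda>i j. if i = p \<and> j = p \<or> i = r \<and> j = r then complex_of_real c
     else if i = p \<and> j = r then - complex_of_real s
     else if i = r \<and> j = p then complex_of_real s else of_bool (i = j))"

definition dilation :: "nat \<Rightarrow> nat \<Rightarrow> complex \<Rightarrow> infmat" where
  "dilation p r z = (\<lambda>i j. if i = j then (if i = p then z else if i = r then inverse z else 1) else 0)"

lemma transvection_mult:
  assumes "p \<noteq> q"
  shows "transvection p q z \<cdot> h = (\<lambda>i j. h i j + (if i = p then z * h q j else 0))"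
proof (intro ext)
  fix i j
  show "(transvection p q z \<cdot> h) i j = h i j + (if i = p then z * h q j else 0)"
    by (subst inf_mult_left[of "if i = p then {p, q} else {i}"])
       (use assms in \<open>auto simp: transvection_def split: if_splits\<close>)
qed

lemma rotation_mult:
  assumes "p \<noteq> r"
  shows "rotation p r c s \<cdot> h = (\<lambda>i j. if i = p then c * h p j - s * h r j
     else if i = r then s * h p j + c * h r j else h i j)"
proof (intro ext)
  fix i j
  show "(rotation p r c s \<cdot> h) i j = (if i = p then c * h p j - s * h r j
     else if i = r then s * h p j + c * h r j else h i j)"
    by (subst inf_mult_left[of "if i = p \<or> i = r then {p, r} else {i}"])
       (use assms in \<open>auto simp: rotation_def\<close>)
qed

lemma dilation_mult:
  "dilation p r z \<cdot> h = (\<lambda>i j. (if i = p then z else if i = r then inverse z else 1) * h i j)"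
proof (intro ext)
  fix i j
  show "(dilation p r z \<cdot> h) i j = (if i = p then z else if i = r then inverse z else 1) * h i j"
    by (subst inf_mult_left[of "{i}"]) (auto simp: dilation_def)
qed

lemma transvection_SL:
  assumes "p < n" "q < n" "p \<noteq> q" shows "transvection p q z \<in> SL n"
proof (rule SL_I)
  have "block n (transvection p q z) = addrow_mat n z p q"
    by (rule eq_matI) (auto simp: block_def transvection_def)
  then show "det (block n (transvection p q z)) = 1"
    using det_addrow_mat[OF \<open>p \<noteq> q\<close>] by simp
qed (use assms in \<open>auto simp: transvection_def\<close>)

lemma transvection_carrier [simp]: "p \<noteq> q \<Longrightarrow> transvection p q z \<in> carrier SL_inf"
  by (rule SL_inf_memI[of _ "Suc (max p q)"]) (auto intro!: transvection_SL)

lemma transvection_add: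
  "p \<noteq> q \<Longrightarrow> transvection p q z \<cdot> transvection p q w = transvection p q (z + w)"
  by (auto simp: transvection_mult fun_eq_iff) (auto simp: transvection_def)

lemma transvection_0 [simp]: "transvection p q 0 = \<one>\<^bsub>SL_inf\<^esub>"
  by (auto simp: transvection_def SL_inf_simps)

lemma transvection_inv: "p \<noteq> q \<Longrightarrow> inv\<^bsub>SL_inf\<^esub> (transvection p q z) = transvection p q (- z)"
  by (rule SLinf.inv_equality) (auto simp: transvection_add)

lemma transvection_commute:
  "\<lbrakk>p \<noteq> q; p' \<noteq> q'; q \<noteq> p'; q' \<noteq> p\<rbrakk> \<Longrightarrow>
   transvection p q z \<cdot> transvection p' q' w = transvection p' q' w \<cdot> transvection p q z"
  by (auto simp: transvection_mult fun_eq_iff) (auto simp: transvection_def)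

lemma transvection_commutator:
  "\<lbrakk>i \<noteq> j; i \<noteq> k; j \<noteq> k\<rbrakk> \<Longrightarrow>
   transvection i k z \<cdot> transvection k j w = transvection i j (z * w) \<cdot> (transvection k j w \<cdot> transvection i k z)"
  by (auto simp: transvection_mult fun_eq_iff) (auto simp: transvection_def)

lemma dilation_eq:
  assumes "p \<noteq> r" "z \<noteq> 0" "e \<noteq> 0"
  shows "dilation p r z = transvection r p ((inverse z - 1) / e) \<cdot> (transvection p r e \<cdot>
    (transvection r p ((z - 1) / e) \<cdot> transvection p r (- e / z)))"
  using assms
  by (auto simp: transvection_mult fun_eq_iff) (auto simp: transvection_def dilation_def field_simps)

lemma dilation_SL:
  assumes "p < n" "r < n" "p \<noteq> r" "z \<noteq> 0" shows "dilation p r z \<in> SL n"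
  unfolding dilation_eq[OF assms(3,4) one_neq_zero]
  using assms by (intro SL_mult_closed transvection_SL) auto

lemma rotation_eq_shears:
  assumes "p \<noteq> r" "c\<^sup>2 + s\<^sup>2 = 1" "c \<noteq> -1"
  shows "rotation p r c s = transvection p r (- complex_of_real (s / (1 + c))) \<cdot>
    (transvection r p (complex_of_real s) \<cdot> transvection p r (- complex_of_real (s / (1 + c))))"
proof -
  define a where "a = s / (1 + c)"
  have "1 + c \<noteq> 0" using assms(3) by linarith
  then have "a * s = 1 - c" "a * (1 + c) = s"
    using assms(2) by (auto simp: a_def field_simps power2_eq_square)
  then have "complex_of_real a * complex_of_real s = 1 - complex_of_real c"
    "complex_of_real a * (1 + complex_of_real c) = complex_of_real s"
    by (metis of_real_1 of_real_diff of_real_mult) (metis \<open>a * (1 + c) = s\<close> of_real_1 of_real_add of_real_mult)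
  then have *: "complex_of_real s * complex_of_real a = 1 - complex_of_real c"
    "complex_of_real a * complex_of_real c = complex_of_real s - complex_of_real a"
    by (simp_all add: algebra_simps)
  have "complex_of_real a * (complex_of_real a * complex_of_real s) =
      complex_of_real a * 2 - complex_of_real s"
    by (subst (2) mult.commute) (simp add: * right_diff_distrib)
  note * = * this
  show ?thesis
    using assms(1) * unfolding a_def[symmetric]
    by (auto simp: transvection_mult fun_eq_iff) (auto simp: transvection_def rotation_def algebra_simps)
qed

lemma rotation_SL:
  assumes "p < n" "r < n" "p \<noteq> r" "c\<^sup>2 + s\<^sup>2 = 1" shows "rotation p r c s \<in> SL n"
proof (cases "c = -1")
  case True
  then have "s = 0" using assms(4) by simp
  then have "rotation p r c s = dilation p r (-1)"
    using True assms(3) by (auto simp: rotation_def dilation_def fun_eq_iff)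
  then show ?thesis using dilation_SL[OF assms(1-3)] by simp
next
  case False
  show ?thesis
    unfolding rotation_eq_shears[OF assms(3,4) False]
    using assms by (intro SL_mult_closed transvection_SL) auto
qed

lemma SU_infI:
  assumes g: "g \<in> SL n" and h: "h \<in> SL n" and hg: "h \<cdot> g = \<one>\<^bsub>SL_inf\<^esub>"
    and adj: "\<And>i j. h i j = cnj (g j i)"
  shows "g \<in> SU_inf"
proof -
  have "mat_adjoint (block n g) = block n h"
    by (rule eq_matI) (auto simp: block_def adj mat_adjoint_def mat_of_rows_def)
  then have "mat_adjoint (block n g) * block n g = block n (h \<cdot> g)"
    by (simp add: block_mult[OF h])
  also have "\<dots> = 1\<^sub>m n" by (simp add: hg block_one)
  finally show ?thesis using g by (auto simp: SU_inf_def SU_def)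
qed

lemma SU_inf_carrier: "k \<in> SU_inf \<Longrightarrow> k \<in> carrier SL_inf"
  by (auto simp: SU_inf_def SU_def intro: SL_inf_memI)

lemma rotation_SU:
  assumes "p \<noteq> r" "c\<^sup>2 + s\<^sup>2 = 1" shows "rotation p r c s \<in> SU_inf"
proof (rule SU_infI)
  let ?n = "Suc (max p r)"
  show "rotation p r c s \<in> SL ?n" "rotation p r c (- s) \<in> SL ?n"
    using assms by (auto intro!: rotation_SL)
  have *: "complex_of_real c * complex_of_real c + complex_of_real s * complex_of_real s = 1"
    using assms(2) by (metis of_real_1 of_real_add of_real_mult power2_eq_square)
  show "rotation p r c (- s) \<cdot> rotation p r c s = \<one>\<^bsub>SL_inf\<^esub>"
  proof (intro ext)
    fix i j
    show "(rotation p r c (- s) \<cdot> rotation p r c s) i j = \<one>\<^bsub>SL_inf\<^esub> i j"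
      using assms(1) * *[unfolded add.commute[of "complex_of_real c * _"]]
      by (subst rotation_mult[OF assms(1)], subst SL_inf_simps(3))
        (simp add: rotation_def)
  qed
  show "rotation p r c (- s) i j = cnj (rotation p r c s j i)" for i j
    using assms(1) by (cases "i = p"; cases "i = r"; cases "j = p"; cases "j = r") (simp_all add: rotation_def)
qed

lemma rotation_carrier: "\<lbrakk>p \<noteq> r; c\<^sup>2 + s\<^sup>2 = 1\<rbrakk> \<Longrightarrow> rotation p r c s \<in> carrier SL_inf"
  by (rule SU_inf_carrier) (rule rotation_SU)

lemma dilation_carrier: "\<lbrakk>p \<noteq> r; z \<noteq> 0\<rbrakk> \<Longrightarrow> dilation p r z \<in> carrier SL_inf"
  by (rule SL_inf_memI[of _ "Suc (max p r)"]) (auto intro!: dilation_SL)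

lemma dilation_SU:
  assumes "p \<noteq> r" "cmod z = 1" shows "dilation p r z \<in> SU_inf"
proof (rule SU_infI)
  let ?n = "Suc (max p r)"
  have z: "z \<noteq> 0" using assms(2) by auto
  show "dilation p r z \<in> SL ?n" "dilation p r (inverse z) \<in> SL ?n"
    using assms(1) z by (auto intro!: dilation_SL)
  show "dilation p r (inverse z) \<cdot> dilation p r z = \<one>\<^bsub>SL_inf\<^esub>"
    using z by (auto simp: dilation_mult fun_eq_iff) (auto simp: dilation_def SL_inf_simps)
  have *: "inverse z = cnj z" using assms(2)
    by (metis complex_norm_square inverse_unique of_real_1 power_one)
  then have "inverse (cnj z) = z"
    by (metis inverse_inverse_eq)
  then show "dilation p r (inverse z) i j = cnj (dilation p r z j i)" for i j
    by (auto simp: dilation_def *)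
qed

lemma rotation_transvection:
  assumes "p \<noteq> r" "q \<noteq> p" "q \<noteq> r" "c\<^sup>2 + s\<^sup>2 = 1"
  shows "rotation p r c s \<cdot> transvection p q z =
    transvection p q (c * z) \<cdot> transvection r q (s * z) \<cdot> rotation p r c s"
proof -
  have "rotation p r c s \<cdot> transvection p q z =
    transvection p q (c * z) \<cdot> (transvection r q (s * z) \<cdot> rotation p r c s)"
    using assms(1-3) by (auto simp: rotation_mult transvection_mult fun_eq_iff)
      (auto simp: rotation_def transvection_def)
  then show ?thesis
    using assms(1-3) rotation_carrier[OF assms(1,4)] by (simp add: SLinf.m_assoc)
qed

lemma quarter_turn_column:
  assumes "p \<noteq> r" "j \<noteq> p" "j \<noteq> r"
  shows "rotation p r 0 1 \<cdot> transvection j p z = transvection j r z \<cdot> rotation p r 0 1"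
  using assms
  by (auto simp: rotation_mult transvection_mult fun_eq_iff) (auto simp: rotation_def transvection_def)

lemma rotation_commute:
  assumes "p \<noteq> r" "i \<noteq> j" "i \<noteq> p" "i \<noteq> r" "j \<noteq> p" "j \<noteq> r"
  shows "rotation p r c s \<cdot> transvection i j z = transvection i j z \<cdot> rotation p r c s"
  using assms
  by (auto simp: rotation_mult transvection_mult fun_eq_iff) (auto simp: rotation_def transvection_def)

lemma dilation_transvection:
  assumes "p \<noteq> r" "q \<noteq> p" "q \<noteq> r" "z \<noteq> 0"
  shows "dilation p r z \<cdot> transvection p q w = transvection p q (z * w) \<cdot> dilation p r z"
  using assms
  by (auto simp: dilation_mult transvection_mult fun_eq_iff) (auto simp: dilation_def transvection_def)

lemma dilation_transvection2:
  assumes "p \<noteq> r" "z \<noteq> 0"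
  shows "dilation p r z \<cdot> transvection p r w = transvection p r (z\<^sup>2 * w) \<cdot> dilation p r z"
  using assms
  by (auto simp: dilation_mult transvection_mult fun_eq_iff)
     (auto simp: dilation_def transvection_def power2_eq_square)

lemma dilation_commute:
  assumes "p \<noteq> r" "i \<noteq> j" "i \<noteq> p" "i \<noteq> r" "j \<noteq> p" "j \<noteq> r" "z \<noteq> 0"
  shows "dilation p r z \<cdot> transvection i j w = transvection i j w \<cdot> dilation p r z"
  using assms
  by (auto simp: dilation_mult transvection_mult fun_eq_iff) (auto simp: dilation_def transvection_def)

lemma SL_commute:
  assumes g: "g \<in> SL n" and x: "x \<in> carrier SL_inf"
    and triv: "\<And>i j. i < n \<or> j < n \<Longrightarrow> x i j = of_bool (i = j)"
  shows "g \<cdot> x = x \<cdot> g"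
proof (intro ext)
  fix i j
  obtain m where m: "x \<in> SL m" using x by (rule SL_inf_memE)
  show "(g \<cdot> x) i j = (x \<cdot> g) i j"
  proof (cases "i < n")
    case True
    have "(g \<cdot> x) i j = (\<Sum>k<n. if k = j then g i k else 0)"
      using True by (auto simp: SL_mult_eq[OF g] triv intro!: sum.cong)
    also have "\<dots> = g i j"
      using SL_outside[OF g, of i j] True by auto
    also have "\<dots> = (x \<cdot> g) i j"
      by (subst inf_mult_left[of "{i}"]) (use True triv in auto)
    finally show ?thesis .
  next
    case False
    have "(x \<cdot> g) i j = (\<Sum>k<m. if k = j then x i j else 0)" if "i < m"
    proof -
      have "x i k * g k j = (if k = j then x i j else 0)" for k
        using False SL_outside[OF g, of k j] triv[of i k] by (cases "k < n") auto
      then show ?thesis using that by (simp add: SL_mult_eq[OF m])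
    qed
    moreover have "(x \<cdot> g) i j = g i j" if "\<not> i < m"
      using that by (simp add: SL_mult_eq[OF m])
    ultimately have "(x \<cdot> g) i j = (if i < m then if j < m then x i j else 0 else g i j)"
      by simp
    then show ?thesis
      using False SL_outside[OF g, of i j] SL_outside[OF m, of i j]
      by (auto simp: SL_mult_eq[OF g])
  qed
qed

lemma transvection_SL_commute:
  assumes "g \<in> SL n" "n \<le> p" "n \<le> q" "p \<noteq> q"
  shows "g \<cdot> transvection p q z = transvection p q z \<cdot> g"
  by (rule SL_commute[OF assms(1) transvection_carrier[OF assms(4)]])
    (use assms(2-4) in \<open>auto simp: transvection_def\<close>)

lemma rotation_SL_commute:
  assumes "g \<in> SL n" "n \<le> p" "n \<le> q" "p \<noteq> q" "c\<^sup>2 + s\<^sup>2 = 1"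
  shows "g \<cdot> rotation p q c s = rotation p q c s \<cdot> g"
  by (rule SL_commute[OF assms(1)]) (use assms(2-4) rotation_carrier[OF assms(4,5)] in \<open>auto simp: rotation_def\<close>)

lemma SL_inv_closed:
  assumes "g \<in> SL n" shows "inv\<^bsub>SL_inf\<^esub> g \<in> SL n"
proof -
  obtain h where "h \<in> SL n" "h \<cdot> g = \<one>\<^bsub>SL_inf\<^esub>"
    using SL_left_inverse[OF assms] by metis
  moreover from this have "inv\<^bsub>SL_inf\<^esub> g = h"
    using assms by (intro SLinf.inv_equality) (auto intro: SL_inf_memI)
  ultimately show ?thesis by simp
qed

lemma subset_SL_common:
  assumes "finite A" "A \<subseteq> carrier SL_inf"
  obtains n where "n > 0" "A \<subseteq> SL n"
proof -
  have "\<exists>n>0. A \<subseteq> SL n"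
    using assms
  proof (induction A)
    case (insert g A)
    then obtain n m where *: "n > 0" "A \<subseteq> SL n" "g \<in> SL m" "m > 0"
      by (metis SL_inf_memE insert_subset)
    then have "insert g A \<subseteq> SL (max m n)"
      using SL_mono[of n "max m n"] SL_mono[of m "max m n"] by auto
    with * show ?case by (metis max.strict_coboundedI1)
  qed auto
  then show thesis using that by blast
qed

lemma SL_0: "SL 0 = {\<one>\<^bsub>SL_inf\<^esub>}"
  by (auto simp: SL_one) (auto simp: SL_def SL_inf_simps fun_eq_iff)

lemma SL_1: "SL (Suc 0) = {\<one>\<^bsub>SL_inf\<^esub>}"
proof -
  have "g = \<one>\<^bsub>SL_inf\<^esub>" if "g \<in> SL (Suc 0)" for g
  proof (rule SL_eqI[OF that SL_one])
    have "det (block (Suc 0) g) = block (Suc 0) g $$ (0, 0)"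
      by (rule det_single) auto
    then have "block (Suc 0) g $$ (0, 0) = 1" using SL_det[OF that] by simp
    then show "block (Suc 0) g = block (Suc 0) \<one>\<^bsub>SL_inf\<^esub>"
      unfolding block_one by (intro eq_matI) auto
  qed
  then show ?thesis using SL_one by auto
qed

section \<open>Conditionally negative kernels\<close>

definition cond_negative_kernel :: "'a set \<Rightarrow> ('a \<Rightarrow> 'a \<Rightarrow> complex) \<Rightarrow> bool" where
  "cond_negative_kernel X K \<longleftrightarrow> (\<forall>x\<in>X. \<forall>y\<in>X. K y x = cnj (K x y)) \<and>
     (\<forall>(n::nat) x c. (\<forall>i<n. x i \<in> X) \<longrightarrow> (\<Sum>i<n. c i) = 0 \<longrightarrow>
        (\<Sum>i<n. \<Sum>j<n. c i * cnj (c j) * K (x i) (x j)) \<in> \<real>\<^sub>\<le>\<^sub>0)"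

lemma cond_negative_kernel_herm:
  "\<lbrakk>cond_negative_kernel X K; x \<in> X; y \<in> X\<rbrakk> \<Longrightarrow> K y x = cnj (K x y)"
  unfolding cond_negative_kernel_def by blast

lemma cond_negative_kernel_sum:
  fixes x :: "'i \<Rightarrow> 'a"
  assumes K: "cond_negative_kernel X K" and I: "finite I"
    and x: "\<And>i. i \<in> I \<Longrightarrow> x i \<in> X" and c: "(\<Sum>i\<in>I. c i) = 0"
  shows "(\<Sum>i\<in>I. \<Sum>j\<in>I. c i * cnj (c j) * K (x i) (x j)) \<in> \<real>\<^sub>\<le>\<^sub>0"
proof -
  obtain h where h: "bij_betw h {..<card I} I"
    using ex_bij_betw_nat_finite[OF I] by (auto simp: atLeast0LessThan)
  have "\<forall>i<card I. x (h i) \<in> X" using h x by (auto dest: bij_betwE)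
  moreover have "(\<Sum>i<card I. c (h i)) = 0"
    using c by (simp only: sum.reindex_bij_betw[OF h])
  ultimately have "(\<Sum>i<card I. \<Sum>j<card I. c (h i) * cnj (c (h j)) * K (x (h i)) (x (h j))) \<in> \<real>\<^sub>\<le>\<^sub>0"
    using K[unfolded cond_negative_kernel_def, THEN conjunct2, THEN spec[of _ "card I"],
        THEN spec[of _ "\<lambda>i. x (h i)"], THEN spec[of _ "\<lambda>i. c (h i)"]] by blast
  then show ?thesis
    by (simp only: sum.reindex_bij_betw[OF h, of "\<lambda>j. c (h i) * cnj (c j) * K (x (h i)) (x j)" for i]
        sum.reindex_bij_betw[OF h, of "\<lambda>i. \<Sum>j\<in>I. c i * cnj (c j) * K (x i) (x j)"])
qed

definition kernel_dist :: "('a \<Rightarrow> 'a \<Rightarrow> complex) \<Rightarrow> 'a \<Rightarrow> 'a \<Rightarrow> real" where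
  "kernel_dist K x y = 2 * Re (K x y) - Re (K x x) - Re (K y y)"

lemma cond_negative_kernel_3:
  assumes K: "cond_negative_kernel X K" and X: "x \<in> X" "y \<in> X" "z \<in> X" and "a + b + c = 0"
  shows "(a * cnj a * K x x + a * cnj b * K x y + a * cnj c * K x z)
    + (b * cnj a * K y x + b * cnj b * K y y + b * cnj c * K y z)
    + (c * cnj a * K z x + c * cnj b * K z y + c * cnj c * K z z) \<in> \<real>\<^sub>\<le>\<^sub>0"
proof -
  have 3: "{..<3::nat} = {0, 1, 2}" by auto
  let ?x = "\<lambda>i::nat. if i = 0 then x else if i = 1 then y else z"
  let ?c = "\<lambda>i::nat. if i = 0 then a else if i = 1 then b else c"
  have "(\<Sum>i<3. \<Sum>j<3. ?c i * cnj (?c j) * K (?x i) (?x j)) \<in> \<real>\<^sub>\<le>\<^sub>0"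
    using X assms(5) by (intro cond_negative_kernel_sum[OF K]) (auto simp: 3 add.assoc)
  then show ?thesis
    unfolding 3 by (simp add: add.assoc add.commute add.left_commute)
qed

lemma kernel_dist_nonneg:
  assumes K: "cond_negative_kernel X K" and X: "x \<in> X" "y \<in> X"
  shows "0 \<le> kernel_dist K x y"
  using cond_negative_kernel_3[OF K X(1,2,2), of 1 "-1" 0] cond_negative_kernel_herm[OF K X]
  by (simp add: complex_nonpos_Reals_iff kernel_dist_def)

lemma kernel_dist_triangle:
  assumes K: "cond_negative_kernel X K" and X: "x \<in> X" "y \<in> X" "z \<in> X"
  shows "kernel_dist K x z \<le> 2 * kernel_dist K x y + 2 * kernel_dist K y z"
  using cond_negative_kernel_3[OF K X, of 1 "-2" 1] cond_negative_kernel_herm[OF K X(1,2)]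
    cond_negative_kernel_herm[OF K X(2,3)] cond_negative_kernel_herm[OF K X(1,3)]
  by (simp add: complex_nonpos_Reals_iff kernel_dist_def)

lemma kernel_dist_Im:
  assumes K: "cond_negative_kernel X K" and X: "x \<in> X" "y \<in> X" "z \<in> X"
  shows "2 * \<bar>Im (K x z) - Im (K x y) - Im (K y z)\<bar> \<le> kernel_dist K x y + kernel_dist K y z"
  using cond_negative_kernel_3[OF K X, of 1 "-1 - \<i>" "\<i>"] cond_negative_kernel_3[OF K X, of 1 "-1 + \<i>" "- \<i>"]
    cond_negative_kernel_herm[OF K X(1,2)]
    cond_negative_kernel_herm[OF K X(2,3)] cond_negative_kernel_herm[OF K X(1,3)]
  by (simp add: complex_nonpos_Reals_iff kernel_dist_def abs_if)

abbreviation column_shear :: "nat \<Rightarrow> real \<Rightarrow> infmat" where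
  "column_shear p s \<equiv> transvection p 0 (complex_of_real s)"

lemma one_SU: "\<one>\<^bsub>SL_inf\<^esub> \<in> SU_inf"
  by (rule SU_infI[OF SL_one[of 0] SL_one]) (simp add: SLinf.one_closed, auto simp: SL_inf_simps)

definition rk :: "infmat \<Rightarrow> nat" where
  "rk g = (LEAST n. n > 0 \<and> g \<in> SL n)"

lemma rk:
  assumes "g \<in> carrier SL_inf"
  shows "rk g > 0" "g \<in> SL (rk g)"
proof -
  have "\<exists>n. n > 0 \<and> g \<in> SL n" using SL_inf_memE[OF assms] by metis
  from LeastI_ex[OF this] show "rk g > 0" "g \<in> SL (rk g)" by (simp_all add: rk_def)
qed

lemma rk_le: "\<lbrakk>g \<in> SL n; n > 0\<rbrakk> \<Longrightarrow> rk g \<le> n"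
  unfolding rk_def by (rule Least_le) simp

lemma intertwine_mult:
  assumes "k \<cdot> x = x' \<cdot> k" "k \<cdot> y = y' \<cdot> k"
    "k \<in> carrier SL_inf" "x \<in> carrier SL_inf" "x' \<in> carrier SL_inf" "y \<in> carrier SL_inf" "y' \<in> carrier SL_inf"
  shows "k \<cdot> (x \<cdot> y) = x' \<cdot> y' \<cdot> k"
  using assms by (metis SLinf.m_assoc)

lemma quarter_turn_row:
  assumes "p \<noteq> r" "q \<noteq> p" "q \<noteq> r"
  shows "rotation p r 0 1 \<cdot> transvection p q z = transvection r q z \<cdot> rotation p r 0 1"
  using rotation_transvection[OF assms, of 0 1 z] assms by simp

locale spherical_negative_type =
  fixes \<psi> :: "infmat \<Rightarrow> complex"
  assumes biinvariant: "biinvariant SL_inf SU_inf \<psi>"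
    and negative_type: "negative_type SL_inf \<psi>"
begin

lemma inv_cnj: "g \<in> carrier SL_inf \<Longrightarrow> \<psi> (inv\<^bsub>SL_inf\<^esub> g) = cnj (\<psi> g)"
  using negative_type unfolding negative_type_def by blast

lemma cond_negative: "cond_negative_kernel (carrier SL_inf) (\<lambda>g h. \<psi> (inv\<^bsub>SL_inf\<^esub> h \<cdot> g))"
  unfolding cond_negative_kernel_def
proof (intro conjI ballI)
  fix g h assume "g \<in> carrier SL_inf" "h \<in> carrier SL_inf"
  then show "\<psi> (inv\<^bsub>SL_inf\<^esub> g \<cdot> h) = cnj (\<psi> (inv\<^bsub>SL_inf\<^esub> h \<cdot> g))"
    using inv_cnj[of "inv\<^bsub>SL_inf\<^esub> h \<cdot> g"] by (simp add: SLinf.inv_mult_group)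
qed (use negative_type in \<open>simp add: negative_type_def\<close>)

lemma conj_invariant:
  assumes "k \<in> SU_inf" "x \<in> carrier SL_inf" "y \<in> carrier SL_inf" "k \<cdot> x = y \<cdot> k"
  shows "\<psi> x = \<psi> y"
proof -
  have "\<psi> (k \<cdot> x \<cdot> \<one>\<^bsub>SL_inf\<^esub>) = \<psi> x" "\<psi> (\<one>\<^bsub>SL_inf\<^esub> \<cdot> y \<cdot> k) = \<psi> y"
    using biinvariant assms(1-3) one_SU unfolding biinvariant_def by blast+
  then show ?thesis
    using assms by (simp add: SU_inf_carrier)
qed

lemma left_invariant: "\<lbrakk>k \<in> SU_inf; g \<in> carrier SL_inf\<rbrakk> \<Longrightarrow> \<psi> (k \<cdot> g) = \<psi> g"
  using biinvariant one_SU unfolding biinvariant_def by (metis SLinf.r_one SLinf.m_closed SU_inf_carrier)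

lemma move_right_row:
  assumes g: "g \<in> SL n" and p: "n > 0" "p \<ge> n" "p' \<ge> n" "q \<ge> n" "p \<noteq> q" "p' \<noteq> q"
  shows "\<psi> (column_shear q r \<cdot> (g \<cdot> column_shear p s)) = \<psi> (column_shear q r \<cdot> (g \<cdot> column_shear p' s))"
proof (cases "p = p'")
  case False
  let ?k = "rotation p p' 0 1"
  note [simp] = SL_inf_memI[OF g]
  have [simp]: "?k \<in> carrier SL_inf" using False by (simp add: rotation_carrier)
  have "?k \<cdot> (column_shear q r \<cdot> (g \<cdot> column_shear p s)) = column_shear q r \<cdot> (g \<cdot> column_shear p' s) \<cdot> ?k"
    using p False
    by (intro intertwine_mult quarter_turn_row rotation_commute rotation_SL_commute[OF g, symmetric]) auto
  then show ?thesis
    using p False by (intro conj_invariant[of ?k]) (auto intro: rotation_SU)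
qed simp

lemma move_left_row:
  assumes g: "g \<in> SL n" and p: "n > 0" "p \<ge> n" "q' \<ge> n" "q \<ge> n" "p \<noteq> q" "p \<noteq> q'"
  shows "\<psi> (column_shear q r \<cdot> (g \<cdot> column_shear p s)) = \<psi> (column_shear q' r \<cdot> (g \<cdot> column_shear p s))"
proof (cases "q = q'")
  case False
  let ?k = "rotation q q' 0 1"
  note [simp] = SL_inf_memI[OF g]
  have [simp]: "?k \<in> carrier SL_inf" using False by (simp add: rotation_carrier)
  have "?k \<cdot> (column_shear q r \<cdot> (g \<cdot> column_shear p s)) = column_shear q' r \<cdot> (g \<cdot> column_shear p s) \<cdot> ?k"
    using p False
    by (intro intertwine_mult quarter_turn_row rotation_commute rotation_SL_commute[OF g, symmetric]) auto
  then show ?thesis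
    using p False by (intro conj_invariant[of ?k]) (auto intro: rotation_SU)
qed simp

lemma move_both_rows:
  assumes g: "g \<in> SL n" and p: "n > 0" "p \<ge> n" "p' \<ge> n"
  shows "\<psi> (column_shear p r \<cdot> (g \<cdot> column_shear p s)) = \<psi> (column_shear p' r \<cdot> (g \<cdot> column_shear p' s))"
proof (cases "p = p'")
  case False
  let ?k = "rotation p p' 0 1"
  note [simp] = SL_inf_memI[OF g]
  have [simp]: "?k \<in> carrier SL_inf" using False by (simp add: rotation_carrier)
  have "?k \<cdot> (column_shear p r \<cdot> (g \<cdot> column_shear p s)) = column_shear p' r \<cdot> (g \<cdot> column_shear p' s) \<cdot> ?k"
    using p False
    by (intro intertwine_mult quarter_turn_row rotation_commute rotation_SL_commute[OF g, symmetric]) auto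
  then show ?thesis
    using p False by (intro conj_invariant[of ?k]) (auto intro: rotation_SU)
qed simp

lemma move_rows:
  assumes g: "g \<in> SL n" and p: "n > 0" "p \<ge> n" "q \<ge> n" "p' \<ge> n" "q' \<ge> n" "p \<noteq> q" "p' \<noteq> q'"
  shows "\<psi> (column_shear q r \<cdot> (g \<cdot> column_shear p s)) = \<psi> (column_shear q' r \<cdot> (g \<cdot> column_shear p' s))"
proof -
  define w where "w = Suc (p + q + p' + q')"
  have w: "w \<ge> n" "w \<noteq> p" "w \<noteq> q" "w \<noteq> p'" "w \<noteq> q'"
    using p by (auto simp: w_def)
  have "\<psi> (column_shear q r \<cdot> (g \<cdot> column_shear p s)) = \<psi> (column_shear w r \<cdot> (g \<cdot> column_shear p s))"
    using p w by (intro move_left_row[OF g]) auto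
  also have "\<dots> = \<psi> (column_shear w r \<cdot> (g \<cdot> column_shear p' s))"
    using p w by (intro move_right_row[OF g]) auto
  also have "\<dots> = \<psi> (column_shear q' r \<cdot> (g \<cdot> column_shear p' s))"
    using p w by (intro move_left_row[OF g]) auto
  finally show ?thesis .
qed

definition far_kernel :: "real \<Rightarrow> infmat \<Rightarrow> real \<Rightarrow> complex" where
  "far_kernel s g r = \<psi> (column_shear (Suc (rk g)) (- r) \<cdot> (g \<cdot> column_shear (rk g) s))"

lemma far_kernel_eq:
  assumes "g \<in> SL n" "n > 0" "p \<ge> n" "q \<ge> n" "p \<noteq> q"
  shows "far_kernel s g r = \<psi> (column_shear q (- r) \<cdot> (g \<cdot> column_shear p s))"
  unfolding far_kernel_def using rk[OF SL_inf_memI[OF assms(1)]] rk_le[OF assms(1,2)] assms(3-5)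
  by (intro move_rows[of g "rk g"]) auto

end

section \<open>Averaging over far rows\<close>

lemma nonpos_Reals_limit_quadratic:
  fixes P Q :: complex
  assumes "\<And>m::nat. m > 0 \<Longrightarrow> of_nat m * P + of_nat (m * (m - 1)) * Q \<in> \<real>\<^sub>\<le>\<^sub>0"
  shows "Q \<in> \<real>\<^sub>\<le>\<^sub>0"
proof -
  have 1: "Im P = 0" using assms[of 1] by (simp add: complex_nonpos_Reals_iff)
  have 2: "Im Q = 0" using assms[of 2] 1 by (simp add: complex_nonpos_Reals_iff)
  have "Re Q \<le> 0"
  proof (rule ccontr)
    assume "\<not> Re Q \<le> 0"
    then have Q: "Re Q > 0" by simp
    obtain k :: nat where k: "- Re P < of_nat k * Re Q"
      using reals_Archimedean3[OF Q] by blast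
    have "real (Suc k) * (Re P + real k * Re Q) \<le> 0"
      using assms[of "Suc k"] by (simp add: complex_nonpos_Reals_iff algebra_simps)
    moreover have "real (Suc k) * (Re P + real k * Re Q) > 0"
      using k by (intro mult_pos_pos) auto
    ultimately show False by simp
  qed
  with 2 show ?thesis by (simp add: complex_nonpos_Reals_iff)
qed

lemma sum_Times: "(\<Sum>u\<in>A \<times> B. f u) = (\<Sum>i\<in>A. \<Sum>a\<in>B. f (i, a))"
  by (simp add: sum.cartesian_product)

lemma sum_offdiag:
  fixes P Q :: complex
  shows "(\<Sum>a<m. \<Sum>b<m. if a = b then P else Q) = of_nat m * P + of_nat (m * (m - 1)) * Q"
proof -
  have "(\<Sum>b<m. if a = b then P else Q) = P + of_nat (m - 1) * Q" if "a < m" for a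
  proof -
    have "(\<Sum>b<m. if a = b then P else Q) = P + (\<Sum>b\<in>{..<m} - {a}. if a = b then P else Q)"
      using that by (subst sum.remove[of _ a]) auto
    also have "(\<Sum>b\<in>{..<m} - {a}. if a = b then P else Q) = (\<Sum>b\<in>{..<m} - {a}. Q)"
      by (intro sum.cong) auto
    finally show ?thesis using that by simp
  qed
  then have "(\<Sum>a<m. \<Sum>b<m. if a = b then P else Q) = (\<Sum>a<m. P + of_nat (m - 1) * Q)"
    by (intro sum.cong) auto
  then show ?thesis by (simp only: sum_constant card_lessThan of_nat_mult) (simp add: distrib_left)
qed

context spherical_negative_type
begin

lemma far_kernel_herm:
  assumes g: "g \<in> carrier SL_inf"
  shows "far_kernel r (inv\<^bsub>SL_inf\<^esub> g) s = cnj (far_kernel s g r)"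
proof -
  let ?n = "rk g"
  note n = rk[OF g]
  have "far_kernel r (inv\<^bsub>SL_inf\<^esub> g) s =
      \<psi> (column_shear ?n (- s) \<cdot> (inv\<^bsub>SL_inf\<^esub> g \<cdot> column_shear (Suc ?n) r))"
    using n SL_inv_closed by (intro far_kernel_eq[of _ ?n]) auto
  also have "\<dots> = \<psi> (inv\<^bsub>SL_inf\<^esub> (column_shear (Suc ?n) (- r) \<cdot> (g \<cdot> column_shear ?n s)))"
    using n g by (simp add: SLinf.inv_mult_group transvection_inv SLinf.m_assoc)
  also have "\<dots> = cnj (far_kernel s g r)"
    unfolding far_kernel_def using n g by (intro inv_cnj) auto
  finally show ?thesis .
qed

text \<open>The far copies of a point are averaged over \<open>m\<close> different rows; for large \<open>m\<close> the diagonal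
  terms, in which the two rows coincide, become negligible.\<close>

lemma far_kernel_cond_negative:
  "cond_negative_kernel (carrier SL_inf \<times> UNIV) (\<lambda>(g, s) (h, r). far_kernel s (inv\<^bsub>SL_inf\<^esub> h \<cdot> g) r)"
  unfolding cond_negative_kernel_def
proof (intro conjI ballI allI impI)
  fix x y :: "infmat \<times> real"
  assume "x \<in> carrier SL_inf \<times> UNIV" "y \<in> carrier SL_inf \<times> UNIV"
  then show "(case y of (g, s) \<Rightarrow> \<lambda>(h, r). far_kernel s (inv\<^bsub>SL_inf\<^esub> h \<cdot> g) r) x =
      cnj ((case x of (g, s) \<Rightarrow> \<lambda>(h, r). far_kernel s (inv\<^bsub>SL_inf\<^esub> h \<cdot> g) r) y)"
    using far_kernel_herm[of "inv\<^bsub>SL_inf\<^esub> fst y \<cdot> fst x" "snd y" "snd x"]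
    by (auto simp: SLinf.inv_mult_group)
next
  fix N :: nat and x :: "nat \<Rightarrow> infmat \<times> real" and c :: "nat \<Rightarrow> complex"
  assume x: "\<forall>i<N. x i \<in> carrier SL_inf \<times> UNIV" and c: "(\<Sum>i<N. c i) = 0"
  define g where "g i = fst (x i)" for i
  define s where "s i = snd (x i)" for i
  have x_eq: "x i = (g i, s i)" for i by (simp add: g_def s_def)
  have g: "g i \<in> carrier SL_inf" if "i < N" for i using x that by (auto simp: g_def)
  obtain n where n: "n > 0" "g ` {..<N} \<subseteq> SL n"
    using subset_SL_common[of "g ` {..<N}"] g by blast
  define gg where "gg i j = inv\<^bsub>SL_inf\<^esub> (g j) \<cdot> g i" for i j
  have gg: "gg i j \<in> SL n" if "i < N" "j < N" for i j
    using n that by (auto simp: gg_def intro!: SL_mult_closed SL_inv_closed)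
  define d where "d i j = \<psi> (column_shear n (- s j) \<cdot> (gg i j \<cdot> column_shear n (s i)))" for i j
  define P where "P = (\<Sum>i<N. \<Sum>j<N. c i * cnj (c j) * d i j)"
  define Q where "Q = (\<Sum>i<N. \<Sum>j<N. c i * cnj (c j) * far_kernel (s i) (gg i j) (s j))"
  have "Q \<in> \<real>\<^sub>\<le>\<^sub>0"
  proof (rule nonpos_Reals_limit_quadratic)
    fix m :: nat
    define y where "y = (\<lambda>(i, a). g i \<cdot> column_shear (n + a) (s i))"
    have y: "\<psi> (inv\<^bsub>SL_inf\<^esub> (y (j, b)) \<cdot> y (i, a)) =
        (if a = b then d i j else far_kernel (s i) (gg i j) (s j))"
      if ij: "i < N" "j < N" for i j a b
    proof -
      have "inv\<^bsub>SL_inf\<^esub> (y (j, b)) \<cdot> y (i, a) =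
          column_shear (n + b) (- s j) \<cdot> (gg i j \<cdot> column_shear (n + a) (s i))"
        using ij n(1) g by (simp add: y_def gg_def SLinf.inv_mult_group SLinf.m_assoc transvection_inv)
      moreover have "\<psi> (column_shear (n + b) (- s j) \<cdot> (gg i j \<cdot> column_shear (n + a) (s i))) =
          far_kernel (s i) (gg i j) (s j)" if "a \<noteq> b"
        using far_kernel_eq[OF gg[OF ij] n(1), of "n + a" "n + b"] that by simp
      moreover have "\<psi> (column_shear (n + a) (- s j) \<cdot> (gg i j \<cdot> column_shear (n + a) (s i))) = d i j"
        unfolding d_def using n(1) by (intro move_both_rows[OF gg[OF ij]]) auto
      ultimately show ?thesis by auto
    qed
    have "(\<Sum>u\<in>{..<N} \<times> {..<m}. \<Sum>v\<in>{..<N} \<times> {..<m}.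
        c (fst u) * cnj (c (fst v)) * \<psi> (inv\<^bsub>SL_inf\<^esub> (y v) \<cdot> y u)) \<in> \<real>\<^sub>\<le>\<^sub>0"
    proof (rule cond_negative_kernel_sum[OF cond_negative])
      have "(\<Sum>u\<in>{..<N} \<times> {..<m}. c (fst u)) = (\<Sum>i<N. \<Sum>a<m. c i)"
        by (simp only: sum_Times fst_conv)
      also have "\<dots> = 0" using c by (simp flip: sum_distrib_left)
      finally show "(\<Sum>u\<in>{..<N} \<times> {..<m}. c (fst u)) = 0" .
    qed (use g n(1) in \<open>auto simp: y_def\<close>)
    also have "(\<Sum>u\<in>{..<N} \<times> {..<m}. \<Sum>v\<in>{..<N} \<times> {..<m}.
        c (fst u) * cnj (c (fst v)) * \<psi> (inv\<^bsub>SL_inf\<^esub> (y v) \<cdot> y u)) =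
        (\<Sum>i<N. \<Sum>a<m. \<Sum>j<N. \<Sum>b<m. c i * cnj (c j) * \<psi> (inv\<^bsub>SL_inf\<^esub> (y (j, b)) \<cdot> y (i, a)))"
      by (simp only: sum_Times fst_conv snd_conv)
    also have "\<dots> = (\<Sum>i<N. \<Sum>a<m. \<Sum>j<N. \<Sum>b<m.
        if a = b then c i * cnj (c j) * d i j else c i * cnj (c j) * far_kernel (s i) (gg i j) (s j))"
      by (intro sum.cong refl) (simp add: y)
    also have "\<dots> = (\<Sum>i<N. \<Sum>j<N. \<Sum>a<m. \<Sum>b<m.
        if a = b then c i * cnj (c j) * d i j else c i * cnj (c j) * far_kernel (s i) (gg i j) (s j))"
      by (intro sum.cong refl sum.swap)
    also have "\<dots> = of_nat m * P + of_nat (m * (m - 1)) * Q"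
      unfolding sum_offdiag by (simp add: P_def Q_def sum.distrib sum_distrib_left mult.assoc)
    finally show "of_nat m * P + of_nat (m * (m - 1)) * Q \<in> \<real>\<^sub>\<le>\<^sub>0" .
  qed
  then show "(\<Sum>i<N. \<Sum>j<N. c i * cnj (c j) *
      (case x i of (g, s) \<Rightarrow> \<lambda>(h, r). far_kernel s (inv\<^bsub>SL_inf\<^esub> h \<cdot> g) r) (x j)) \<in> \<real>\<^sub>\<le>\<^sub>0"
    by (simp add: x_eq Q_def gg_def)
qed

end

definition column_centralizer :: "infmat set" where
  "column_centralizer = {g \<in> carrier SL_inf. \<forall>\<^sub>F p in sequentially.
     \<forall>s. g \<cdot> column_shear p s = column_shear p s \<cdot> g}"

lemma column_centralizer_carrier: "g \<in> column_centralizer \<Longrightarrow> g \<in> carrier SL_inf"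
  by (simp add: column_centralizer_def)

lemma column_centralizerI:
  assumes "g \<in> carrier SL_inf" "\<And>p s. p > n \<Longrightarrow> g \<cdot> column_shear p s = column_shear p s \<cdot> g"
  shows "g \<in> column_centralizer"
  using assms unfolding column_centralizer_def by (auto simp: eventually_at_top_dense)

lemma column_centralizer_one: "\<one>\<^bsub>SL_inf\<^esub> \<in> column_centralizer"
  by (rule column_centralizerI[of _ 0]) auto

lemma column_centralizer_mult:
  assumes "g \<in> column_centralizer" "h \<in> column_centralizer"
  shows "g \<cdot> h \<in> column_centralizer"
proof -
  note [simp] = column_centralizer_carrier[OF assms(1)] column_centralizer_carrier[OF assms(2)]
  have "\<forall>\<^sub>F p in sequentially. p > 0 \<and> (\<forall>s. g \<cdot> column_shear p s = column_shear p s \<cdot> g) \<and>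
      (\<forall>s. h \<cdot> column_shear p s = column_shear p s \<cdot> h)"
    using assms unfolding column_centralizer_def by (simp add: eventually_conj eventually_gt_at_top)
  then have "\<forall>\<^sub>F p in sequentially. \<forall>s. g \<cdot> h \<cdot> column_shear p s = column_shear p s \<cdot> (g \<cdot> h)"
  proof eventually_elim
    case (elim p)
    then show ?case by (simp add: SLinf.m_assoc) (simp flip: SLinf.m_assoc)
  qed
  then show ?thesis by (simp add: column_centralizer_def)
qed

lemma column_centralizer_inv:
  assumes "g \<in> column_centralizer"
  shows "inv\<^bsub>SL_inf\<^esub> g \<in> column_centralizer"
proof -
  note [simp] = column_centralizer_carrier[OF assms(1)]
  have "\<forall>\<^sub>F p in sequentially. p > 0 \<and> (\<forall>s. g \<cdot> column_shear p s = column_shear p s \<cdot> g)"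
    using assms unfolding column_centralizer_def by (simp add: eventually_conj eventually_gt_at_top)
  then have "\<forall>\<^sub>F p in sequentially. \<forall>s. inv\<^bsub>SL_inf\<^esub> g \<cdot> column_shear p s = column_shear p s \<cdot> inv\<^bsub>SL_inf\<^esub> g"
  proof eventually_elim
    case (elim p)
    show ?case
    proof
      fix s
      have [simp]: "p > 0" and *: "g \<cdot> column_shear p s = column_shear p s \<cdot> g"
        using elim by auto
      have "inv\<^bsub>SL_inf\<^esub> g \<cdot> column_shear p s = inv\<^bsub>SL_inf\<^esub> g \<cdot> (column_shear p s \<cdot> g) \<cdot> inv\<^bsub>SL_inf\<^esub> g"
        by (simp add: SLinf.m_assoc)
      also have "\<dots> = inv\<^bsub>SL_inf\<^esub> g \<cdot> (g \<cdot> column_shear p s) \<cdot> inv\<^bsub>SL_inf\<^esub> g"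
        by (simp only: *)
      also have "\<dots> = column_shear p s \<cdot> inv\<^bsub>SL_inf\<^esub> g"
        by (simp flip: SLinf.m_assoc)
      finally show "inv\<^bsub>SL_inf\<^esub> g \<cdot> column_shear p s = column_shear p s \<cdot> inv\<^bsub>SL_inf\<^esub> g" .
    qed
  qed
  then show ?thesis by (simp add: column_centralizer_def)
qed

lemma column_centralizer_shear:
  "p > 0 \<Longrightarrow> transvection p 0 z \<in> column_centralizer"
  by (rule column_centralizerI[of _ 0]) (auto intro: transvection_commute)

lemma column_centralizer_dilation:
  "\<lbrakk>p > 0; r > 0; p \<noteq> r; z \<noteq> 0\<rbrakk> \<Longrightarrow> dilation p r z \<in> column_centralizer"
  by (rule column_centralizerI[of _ "p + r"]) (auto intro!: dilation_commute dilation_carrier)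

lemma column_centralizer_common:
  assumes "finite A" "A \<subseteq> column_centralizer"
  obtains n where "n > 0" "A \<subseteq> SL n"
    "\<And>g p s. g \<in> A \<Longrightarrow> p \<ge> n \<Longrightarrow> g \<cdot> column_shear p s = column_shear p s \<cdot> g"
proof -
  obtain n where n: "n > 0" "A \<subseteq> SL n"
    using subset_SL_common[of A] assms column_centralizer_carrier by blast
  have "\<forall>\<^sub>F p in sequentially. \<forall>g\<in>A. \<forall>s. g \<cdot> column_shear p s = column_shear p s \<cdot> g"
    using assms by (intro eventually_ball_finite) (auto simp: column_centralizer_def)
  then obtain m where "\<And>p g s. p \<ge> m \<Longrightarrow> g \<in> A \<Longrightarrow> g \<cdot> column_shear p s = column_shear p s \<cdot> g"
    unfolding eventually_sequentially by blast
  then show thesis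
    using n SL_mono[of n "max m n"] by (intro that[of "max m n"]) auto
qed

section \<open>Translation by a far column shear\<close>

lemma cond_negative_kernelI_all:
  assumes "\<And>x y. \<lbrakk>x \<in> X; y \<in> X\<rbrakk> \<Longrightarrow> K y x = cnj (K x y)"
    and "\<And>(n::nat) x c. (\<And>i. i < n \<Longrightarrow> x i \<in> X) \<Longrightarrow>
      (\<Sum>i<n. \<Sum>j<n. c i * cnj (c j) * K (x i) (x j)) \<in> \<real>\<^sub>\<le>\<^sub>0"
  shows "cond_negative_kernel X K"
  unfolding cond_negative_kernel_def using assms by blast

context spherical_negative_type
begin

text \<open>The function \<open>\<psi>\<^sub>t\<close> of the introduction.\<close>

definition shift :: "real \<Rightarrow> infmat \<Rightarrow> complex" where
  "shift t g = \<psi> (g \<cdot> column_shear (rk g) (sqrt t))"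

lemma shift_combine:
  assumes g: "g \<in> SL n" and p: "n > 0" "p \<ge> n" "r \<ge> n" "p \<noteq> r"
  shows "\<psi> (g \<cdot> (column_shear p x \<cdot> column_shear r y)) = shift (x\<^sup>2 + y\<^sup>2) g"
proof -
  note [simp] = SL_inf_memI[OF g]
  have [simp]: "p > 0" "r > 0" using p by auto
  let ?\<rho> = "sqrt (x\<^sup>2 + y\<^sup>2)"
  have "\<psi> (g \<cdot> column_shear p ?\<rho>) = \<psi> (g \<cdot> (column_shear p x \<cdot> column_shear r y))"
  proof (cases "x = 0 \<and> y = 0")
    case False
    then have *: "x\<^sup>2 + y\<^sup>2 > 0" using sum_power2_gt_zero_iff[of x y] by blast
    then have \<rho>: "?\<rho> \<noteq> 0" using real_sqrt_gt_zero by fastforce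
    define c s where "c = x / ?\<rho>" and "s = y / ?\<rho>"
    have cs: "c\<^sup>2 + s\<^sup>2 = 1"
    proof -
      have "c\<^sup>2 = x\<^sup>2 / (x\<^sup>2 + y\<^sup>2)" "s\<^sup>2 = y\<^sup>2 / (x\<^sup>2 + y\<^sup>2)"
        by (simp_all add: c_def s_def power_divide)
      then show ?thesis using * by (metis add_divide_distrib divide_self less_irrefl)
    qed
    let ?k = "rotation p r c s"
    have [simp]: "?k \<in> carrier SL_inf" using p(4) cs by (rule rotation_carrier)
    have "complex_of_real c * complex_of_real ?\<rho> = complex_of_real x"
      "complex_of_real s * complex_of_real ?\<rho> = complex_of_real y"
      unfolding of_real_mult[symmetric] using \<rho> by (simp_all add: c_def s_def)
    then have "?k \<cdot> column_shear p ?\<rho> = column_shear p x \<cdot> column_shear r y \<cdot> ?k"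
      using rotation_transvection[OF p(4) _ _ cs, of 0 "complex_of_real ?\<rho>"] by simp
    then have "?k \<cdot> (g \<cdot> column_shear p ?\<rho>) = g \<cdot> (column_shear p x \<cdot> column_shear r y) \<cdot> ?k"
      using p cs by (intro intertwine_mult rotation_SL_commute[OF g, symmetric]) auto
    then show ?thesis
      using p(4) cs by (intro conj_invariant[of ?k]) (auto intro: rotation_SU)
  qed simp
  moreover have "\<psi> (g \<cdot> column_shear p ?\<rho>) = shift (x\<^sup>2 + y\<^sup>2) g"
    unfolding shift_def using rk[OF SL_inf_memI[OF g]] rk_le[OF g p(1)] p
      move_right_row[of g "rk g" p "rk g" "Suc (p + rk g)" 0 ?\<rho>]
    by simp
  ultimately show ?thesis by simp
qed

lemma shift_single:
  assumes "g \<in> SL n" "n > 0" "p \<ge> n"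
  shows "\<psi> (g \<cdot> column_shear p x) = shift (x\<^sup>2) g"
  using shift_combine[OF assms, of "Suc p" x 0] assms by (simp add: SL_inf_memI)

lemma shift_0: "g \<in> carrier SL_inf \<Longrightarrow> shift 0 g = \<psi> g"
  by (simp add: shift_def)

lemma shift_shear:
  assumes g: "g \<in> SL n" and n: "n > 0" "w \<ge> n" and t: "t \<ge> 0"
  shows "shift t (g \<cdot> column_shear w r) = shift (t + r\<^sup>2) g"
proof -
  have "g \<cdot> column_shear w r \<in> SL (Suc w)"
    using n g SL_mono[of n "Suc w"] by (intro SL_mult_closed transvection_SL) auto
  from shift_single[OF this, of "Suc w" "sqrt t"]
  have "shift t (g \<cdot> column_shear w r) = \<psi> (g \<cdot> column_shear w r \<cdot> column_shear (Suc w) (sqrt t))"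
    using t by simp
  also have "\<dots> = shift (r\<^sup>2 + t) g"
    using shift_combine[OF g n(1), of w "Suc w" r "sqrt t"] n t SL_inf_memI[OF g]
    by (simp add: SLinf.m_assoc)
  finally show ?thesis by (simp add: add.commute)
qed

lemma far_kernel_shift:
  assumes "g \<in> column_centralizer"
  shows "far_kernel s g r = shift (s\<^sup>2 + r\<^sup>2) g"
proof -
  obtain n where n: "n > 0" "g \<in> SL n"
    "\<And>p s. p \<ge> n \<Longrightarrow> g \<cdot> column_shear p s = column_shear p s \<cdot> g"
  proof (rule column_centralizer_common[of "{g}"])
    fix n assume "n > 0" "{g} \<subseteq> SL n"
      "\<And>h p s. h \<in> {g} \<Longrightarrow> p \<ge> n \<Longrightarrow> h \<cdot> column_shear p s = column_shear p s \<cdot> h"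
    then show thesis by (intro that[of n]) blast+
  qed (use assms in auto)
  note [simp] = SL_inf_memI[OF n(2)]
  have "far_kernel s g r = \<psi> (column_shear (Suc n) (- r) \<cdot> (g \<cdot> column_shear n s))"
    using n by (intro far_kernel_eq[OF n(2,1)]) auto
  also have "column_shear (Suc n) (- r) \<cdot> (g \<cdot> column_shear n s) =
      g \<cdot> (column_shear (Suc n) (- r) \<cdot> column_shear n s)"
    using n(1) n(3)[of "Suc n" "- r"] by (simp flip: SLinf.m_assoc)
  also have "\<psi> \<dots> = shift ((- r)\<^sup>2 + s\<^sup>2) g"
    using n by (intro shift_combine[OF n(2,1)]) auto
  finally show ?thesis by (simp add: add.commute)
qed

lemma shift_cnj:
  assumes "g \<in> column_centralizer" "t \<ge> 0"
  shows "shift t (inv\<^bsub>SL_inf\<^esub> g) = cnj (shift t g)"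
  using far_kernel_herm[OF column_centralizer_carrier[OF assms(1)], of "sqrt t" 0] assms
  by (simp add: far_kernel_shift column_centralizer_inv)

lemma shift_increment_positive:
  fixes N :: nat and g :: "nat \<Rightarrow> infmat"
  assumes g: "\<And>i. i < N \<Longrightarrow> g i \<in> column_centralizer" and t: "t \<ge> 0" "u \<ge> 0"
  shows "(\<Sum>i<N. \<Sum>j<N. c i * cnj (c j) *
    (shift t (inv\<^bsub>SL_inf\<^esub> (g j) \<cdot> g i) - shift (t + u) (inv\<^bsub>SL_inf\<^esub> (g j) \<cdot> g i))) \<in> \<real>\<^sub>\<le>\<^sub>0"
proof -
  define gg where "gg i j = inv\<^bsub>SL_inf\<^esub> (g j) \<cdot> g i" for i j
  have gg: "gg i j \<in> column_centralizer" if "i < N" "j < N" for i j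
    using that g by (auto simp: gg_def intro: column_centralizer_mult column_centralizer_inv)
  obtain n where n: "n > 0" "g ` {..<N} \<union> case_prod gg ` ({..<N} \<times> {..<N}) \<subseteq> SL n"
    "\<And>i j p s. i < N \<Longrightarrow> j < N \<Longrightarrow> p \<ge> n \<Longrightarrow> gg i j \<cdot> column_shear p s = column_shear p s \<cdot> gg i j"
  proof (rule column_centralizer_common[of "g ` {..<N} \<union> case_prod gg ` ({..<N} \<times> {..<N})"])
    fix n assume "n > 0" "g ` {..<N} \<union> case_prod gg ` ({..<N} \<times> {..<N}) \<subseteq> SL n"
      "\<And>h p s. h \<in> g ` {..<N} \<union> case_prod gg ` ({..<N} \<times> {..<N}) \<Longrightarrow> p \<ge> n \<Longrightarrow>
        h \<cdot> column_shear p s = column_shear p s \<cdot> h"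
    then show thesis by (intro that[of n]) blast+
  qed (use g gg in auto)
  have gc [simp]: "g i \<in> carrier SL_inf" if "i < N" for i
    using g[OF that] by (rule column_centralizer_carrier)
  have ggn: "gg i j \<in> SL n" if "i < N" "j < N" for i j
    using n(2) that by auto
  define T where "T = column_shear n (sqrt u)"
  have T: "T \<in> column_centralizer" "T \<in> carrier SL_inf" "inv\<^bsub>SL_inf\<^esub> T = column_shear n (- sqrt u)"
    using n(1) by (auto simp: T_def transvection_inv intro: column_centralizer_shear)
  have invcomm: "inv\<^bsub>SL_inf\<^esub> T \<cdot> gg i j = gg i j \<cdot> inv\<^bsub>SL_inf\<^esub> T" if "i < N" "j < N" for i j
    unfolding T(3) using n(3)[OF that, of n "- sqrt u"] by simp
  define s where "s = sqrt (t / 2)"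
  have s: "s\<^sup>2 + s\<^sup>2 = t" using t by (simp add: s_def)
  define x where "x = (\<lambda>(i, b). (if b then g i \<cdot> T else g i, s))"
  define d where "d = (\<lambda>(i, b). if b then - c i else c i)"
  let ?K = "\<lambda>(g, s) (h, r). far_kernel s (inv\<^bsub>SL_inf\<^esub> h \<cdot> g) r"
  have K: "?K (x (i, a)) (x (j, b)) = (if a = b then shift t (gg i j) else shift (t + u) (gg i j))"
    if ij: "i < N" "j < N" for i j a b
  proof -
    note ggc [simp] = column_centralizer_carrier[OF gg[OF ij]]
    have 1: "inv\<^bsub>SL_inf\<^esub> (g j \<cdot> T) \<cdot> g i = gg i j \<cdot> inv\<^bsub>SL_inf\<^esub> T"
      using ij T(2) invcomm[OF ij] by (simp add: SLinf.inv_mult_group SLinf.m_assoc) (simp add: gg_def SLinf.m_assoc)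
    have 2: "inv\<^bsub>SL_inf\<^esub> (g j) \<cdot> (g i \<cdot> T) = gg i j \<cdot> T"
      using ij T(2) by (simp add: gg_def SLinf.m_assoc)
    have "inv\<^bsub>SL_inf\<^esub> (g j \<cdot> T) \<cdot> (g i \<cdot> T) = inv\<^bsub>SL_inf\<^esub> (g j \<cdot> T) \<cdot> g i \<cdot> T"
      using ij T(2) by (simp add: SLinf.m_assoc)
    also have "\<dots> = gg i j"
      unfolding 1 using T(2) by (simp add: SLinf.m_assoc)
    finally have 3: "inv\<^bsub>SL_inf\<^esub> (g j \<cdot> T) \<cdot> (g i \<cdot> T) = gg i j" .
    have "shift t (gg i j \<cdot> T) = shift (t + u) (gg i j)"
      unfolding T_def using shift_shear[OF ggn[OF ij] n(1), of n t "sqrt u"] t by simp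
    moreover have "shift t (gg i j \<cdot> inv\<^bsub>SL_inf\<^esub> T) = shift (t + u) (gg i j)"
      unfolding T(3) using shift_shear[OF ggn[OF ij] n(1), of n t "- sqrt u"] t by simp
    ultimately show ?thesis
      using gg[OF ij] T(1) unfolding x_def
      by (auto simp: 1 2 3 far_kernel_shift s column_centralizer_mult column_centralizer_inv gg_def[symmetric])
  qed
  have "(\<Sum>i\<in>{..<N} \<times> UNIV. \<Sum>j\<in>{..<N} \<times> UNIV. d i * cnj (d j) * ?K (x i) (x j)) \<in> \<real>\<^sub>\<le>\<^sub>0"
  proof (rule cond_negative_kernel_sum[OF far_kernel_cond_negative])
    show "sum d ({..<N} \<times> UNIV) = 0"
      unfolding sum_Times by (simp add: d_def UNIV_bool)
  qed (use T(2) in \<open>auto simp: x_def\<close>)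
  also have "(\<Sum>i\<in>{..<N} \<times> UNIV. \<Sum>j\<in>{..<N} \<times> UNIV. d i * cnj (d j) * ?K (x i) (x j)) =
     (\<Sum>i<N. \<Sum>a\<in>UNIV. \<Sum>j<N. \<Sum>b\<in>UNIV. d (i, a) * cnj (d (j, b)) *
       (if a = b then shift t (gg i j) else shift (t + u) (gg i j)))"
    unfolding sum_Times by (intro sum.cong refl) (simp only: K lessThan_iff)
  also have "\<dots> = 2 * (\<Sum>i<N. \<Sum>j<N. c i * cnj (c j) * (shift t (gg i j) - shift (t + u) (gg i j)))"
    unfolding sum_distrib_left
    by (intro sum.cong refl) (simp add: UNIV_bool d_def algebra_simps flip: sum.distrib)
  finally show ?thesis
    by (simp add: complex_nonpos_Reals_iff gg_def)
qed

lemma shift_increment_kernel: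
  assumes "t \<ge> 0" "u \<ge> 0"
  shows "cond_negative_kernel column_centralizer
    (\<lambda>g h. shift t (inv\<^bsub>SL_inf\<^esub> h \<cdot> g) - shift (t + u) (inv\<^bsub>SL_inf\<^esub> h \<cdot> g))"
proof (rule cond_negative_kernelI_all)
  fix g h assume gh: "g \<in> column_centralizer" "h \<in> column_centralizer"
  have "inv\<^bsub>SL_inf\<^esub> g \<cdot> h = inv\<^bsub>SL_inf\<^esub> (inv\<^bsub>SL_inf\<^esub> h \<cdot> g)"
    using gh by (simp add: SLinf.inv_mult_group column_centralizer_carrier)
  then show "shift t (inv\<^bsub>SL_inf\<^esub> g \<cdot> h) - shift (t + u) (inv\<^bsub>SL_inf\<^esub> g \<cdot> h) =
      cnj (shift t (inv\<^bsub>SL_inf\<^esub> h \<cdot> g) - shift (t + u) (inv\<^bsub>SL_inf\<^esub> h \<cdot> g))"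
    using gh assms by (simp add: shift_cnj column_centralizer_mult column_centralizer_inv)
qed (use shift_increment_positive assms in blast)

end

section \<open>The values on column shears are bounded\<close>

context spherical_negative_type
begin

definition shear_value :: "real \<Rightarrow> real" where
  "shear_value t = Re (shift t \<one>\<^bsub>SL_inf\<^esub>)"

lemma shift_one: "t \<ge> 0 \<Longrightarrow> shift t \<one>\<^bsub>SL_inf\<^esub> = complex_of_real (shear_value t)"
  using shift_cnj[OF column_centralizer_one, of t]
  by (auto simp: shear_value_def complex_eq_iff)

lemma shift_column_shear:
  assumes "p > 0" "t \<ge> 0"
  shows "shift t (column_shear p r) = complex_of_real (shear_value (t + r\<^sup>2))"
  using shift_shear[OF SL_one[of 1], of p t r] assms by (simp add: shift_one)

lemma shear_value_mono:
  assumes "0 \<le> s" "s \<le> t"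
  shows "shear_value s \<le> shear_value t"
  using shift_increment_positive[of 1 "\<lambda>_. \<one>\<^bsub>SL_inf\<^esub>" s "t - s" "\<lambda>_. 1"] assms
  by (simp add: column_centralizer_one shift_one complex_nonpos_Reals_iff)

definition increment_defect :: "real \<Rightarrow> real \<Rightarrow> infmat \<Rightarrow> real" where
  "increment_defect t u g = shear_value (t + u) - shear_value t - Re (shift (t + u) g - shift t g)"

lemma increment_defect_dist:
  assumes "g \<in> column_centralizer" "h \<in> column_centralizer" "t \<ge> 0" "u \<ge> 0"
  shows "kernel_dist (\<lambda>g h. shift t (inv\<^bsub>SL_inf\<^esub> h \<cdot> g) - shift (t + u) (inv\<^bsub>SL_inf\<^esub> h \<cdot> g)) g h =
    2 * increment_defect t u (inv\<^bsub>SL_inf\<^esub> h \<cdot> g)"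
  using assms(3,4) column_centralizer_carrier[OF assms(1)] column_centralizer_carrier[OF assms(2)]
  by (simp add: kernel_dist_def increment_defect_def shift_one)

lemma increment_defect_nonneg:
  assumes "g \<in> column_centralizer" "t \<ge> 0" "u \<ge> 0"
  shows "0 \<le> increment_defect t u g"
  using kernel_dist_nonneg[OF shift_increment_kernel[OF assms(2,3)] assms(1) column_centralizer_one]
    increment_defect_dist[OF assms(1) column_centralizer_one assms(2,3)] column_centralizer_carrier[OF assms(1)]
  by simp

lemma increment_defect_mult:
  assumes "g \<in> column_centralizer" "h \<in> column_centralizer" "t \<ge> 0" "u \<ge> 0"
  shows "increment_defect t u (g \<cdot> h) \<le> 2 * increment_defect t u g + 2 * increment_defect t u h"
proof -
  note [simp] = column_centralizer_carrier[OF assms(1)] column_centralizer_carrier[OF assms(2)]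
  note gh = column_centralizer_mult[OF assms(1,2)]
  have "inv\<^bsub>SL_inf\<^esub> g \<cdot> (g \<cdot> h) = h" by (simp flip: SLinf.m_assoc)
  then show ?thesis
    using kernel_dist_triangle[OF shift_increment_kernel[OF assms(3,4)] gh assms(1) column_centralizer_one]
    by (simp add: increment_defect_dist gh assms column_centralizer_one)
qed

lemma increment_defect_inv:
  assumes "g \<in> column_centralizer" "t \<ge> 0" "u \<ge> 0"
  shows "increment_defect t u (inv\<^bsub>SL_inf\<^esub> g) = increment_defect t u g"
  using assms by (simp add: increment_defect_def shift_cnj)

lemma increment_defect_shear:
  assumes "p > 0" "t \<ge> 0" "u \<ge> 0"
  shows "increment_defect t u (column_shear p r) =
    (shear_value (t + u) - shear_value t) - (shear_value (t + u + r\<^sup>2) - shear_value (t + r\<^sup>2))"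
  using assms by (simp add: increment_defect_def shift_column_shear)

lemma shear_value_increments_decrease:
  assumes "0 \<le> s" "s \<le> t" "0 \<le> u"
  shows "shear_value (t + u) - shear_value t \<le> shear_value (s + u) - shear_value s"
  using increment_defect_nonneg[OF column_centralizer_shear[of 1 "complex_of_real (sqrt (t - s))"], of s u]
    increment_defect_shear[of 1 s u "sqrt (t - s)"] assms
  by (simp add: algebra_simps)

lemma shear_value_slope:
  assumes "0 \<le> z" "0 \<le> \<tau>" "z + of_nat N * \<tau> \<le> y"
  shows "of_nat N * (shear_value (y + \<tau>) - shear_value y) \<le> shear_value (z + of_nat N * \<tau>) - shear_value z"
  using assms(3)
proof (induction N)
  case (Suc N)
  have "z + of_nat N * \<tau> \<le> y" using Suc.prems assms(2) by (simp add: algebra_simps)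
  moreover from this have "shear_value (y + \<tau>) - shear_value y \<le>
      shear_value (z + of_nat N * \<tau> + \<tau>) - shear_value (z + of_nat N * \<tau>)"
    using assms by (intro shear_value_increments_decrease) auto
  ultimately show ?case
    using Suc.IH by (simp add: algebra_simps)
qed simp

lemma shear_conjugate:
  defines "a \<equiv> dilation 1 2 64"
  shows "column_shear 1 (64 * r) = a \<cdot> (column_shear 1 r \<cdot> inv\<^bsub>SL_inf\<^esub> a)"
proof -
  have [simp]: "a \<in> carrier SL_inf" unfolding a_def by (rule dilation_carrier) auto
  have "a \<cdot> column_shear 1 r = column_shear 1 (64 * r) \<cdot> a"
    unfolding a_def using dilation_transvection[of 1 2 0 64 "complex_of_real r"] by simp
  then have "a \<cdot> column_shear 1 r \<cdot> inv\<^bsub>SL_inf\<^esub> a = column_shear 1 (64 * r)"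
    by (simp add: SLinf.m_assoc)
  then show ?thesis by (simp add: SLinf.m_assoc)
qed

lemma increment_defect_scaled_shear:
  assumes "t \<ge> 0" "u \<ge> 0"
  shows "increment_defect t u (column_shear 1 (64 * r)) \<le>
    4 * increment_defect t u (column_shear 1 r) + 6 * increment_defect t u (dilation 1 2 64)"
proof -
  let ?a = "dilation 1 2 64" and ?T = "column_shear 1 r"
  have mem: "?a \<in> column_centralizer" "inv\<^bsub>SL_inf\<^esub> ?a \<in> column_centralizer" "?T \<in> column_centralizer"
    by (auto intro!: column_centralizer_dilation column_centralizer_inv column_centralizer_shear)
  have "increment_defect t u (?a \<cdot> (?T \<cdot> inv\<^bsub>SL_inf\<^esub> ?a)) \<le>
      2 * increment_defect t u ?a + 2 * increment_defect t u (?T \<cdot> inv\<^bsub>SL_inf\<^esub> ?a)"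
    using mem assms by (intro increment_defect_mult column_centralizer_mult) auto
  also have "increment_defect t u (?T \<cdot> inv\<^bsub>SL_inf\<^esub> ?a) \<le> 2 * increment_defect t u ?T + 2 * increment_defect t u ?a"
    using increment_defect_mult[OF mem(3,2) assms] mem(1) assms by (simp add: increment_defect_inv)
  finally have "increment_defect t u (?a \<cdot> (?T \<cdot> inv\<^bsub>SL_inf\<^esub> ?a)) \<le>
      4 * increment_defect t u ?T + 6 * increment_defect t u ?a" by simp
  then show ?thesis by (simp only: shear_conjugate)
qed

lemma shear_value_scaled:
  "\<exists>D. \<forall>t\<ge>0. shear_value (4096 * t) \<le> 4 * shear_value t + D"
proof -
  let ?a = "dilation 1 2 64"
  define len where "len g = Re (\<psi> g) - Re (\<psi> \<one>\<^bsub>SL_inf\<^esub>)" for g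
  have dist: "kernel_dist (\<lambda>g h. \<psi> (inv\<^bsub>SL_inf\<^esub> h \<cdot> g)) g h = 2 * len (inv\<^bsub>SL_inf\<^esub> h \<cdot> g)"
    if "g \<in> carrier SL_inf" "h \<in> carrier SL_inf" for g h
    using that by (simp add: kernel_dist_def len_def)
  have mult: "len (g \<cdot> h) \<le> 2 * len g + 2 * len h"
    if [simp]: "g \<in> carrier SL_inf" "h \<in> carrier SL_inf" for g h
  proof -
    have "inv\<^bsub>SL_inf\<^esub> g \<cdot> (g \<cdot> h) = h" by (simp flip: SLinf.m_assoc)
    then show ?thesis
      using kernel_dist_triangle[OF cond_negative, of "g \<cdot> h" g "\<one>\<^bsub>SL_inf\<^esub>"] by (simp add: dist)
  qed
  have a: "?a \<in> carrier SL_inf" by (rule dilation_carrier) auto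
  have T: "len (column_shear 1 r) = shear_value (r\<^sup>2) - shear_value 0" for r
    using shift_column_shear[of 1 0 r] by (simp add: len_def shift_0 shear_value_def)
  have scaled: "len (column_shear 1 (64 * r)) \<le> 4 * len (column_shear 1 r) + 6 * len ?a" for r
  proof -
    have "len (?a \<cdot> (column_shear 1 r \<cdot> inv\<^bsub>SL_inf\<^esub> ?a)) \<le> 2 * len ?a + 2 * len (column_shear 1 r \<cdot> inv\<^bsub>SL_inf\<^esub> ?a)"
      using a by (intro mult) auto
    also have "len (column_shear 1 r \<cdot> inv\<^bsub>SL_inf\<^esub> ?a) \<le> 2 * len (column_shear 1 r) + 2 * len (inv\<^bsub>SL_inf\<^esub> ?a)"
      using a by (intro mult) auto
    also have "len (inv\<^bsub>SL_inf\<^esub> ?a) = len ?a"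
      using a by (simp add: len_def inv_cnj)
    finally have "len (?a \<cdot> (column_shear 1 r \<cdot> inv\<^bsub>SL_inf\<^esub> ?a)) \<le> 4 * len (column_shear 1 r) + 6 * len ?a"
      by simp
    then show ?thesis by (simp only: shear_conjugate)
  qed
  have "shear_value (4096 * t) - shear_value 0 \<le> 4 * (shear_value t - shear_value 0) + 6 * len ?a"
    if "t \<ge> 0" for t
    using scaled[of "sqrt t"] that unfolding T by (simp add: power_mult_distrib)
  then have "\<forall>t\<ge>0. shear_value (4096 * t) \<le> 4 * shear_value t + (6 * len ?a - 3 * shear_value 0)"
    by (auto simp: algebra_simps)
  then show ?thesis by blast
qed

lemma Re_shift_ge:
  assumes "g \<in> column_centralizer" "t \<ge> 0"
  shows "shear_value t \<le> Re (shift t g)"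
  using kernel_dist_nonneg[OF far_kernel_cond_negative, of "(g, sqrt (t / 2))" "(\<one>\<^bsub>SL_inf\<^esub>, sqrt (t / 2))"]
    assms column_centralizer_carrier[OF assms(1)]
  by (simp add: kernel_dist_def far_kernel_shift column_centralizer_one shift_one)

text \<open>The dilation rescales the column shears by 64. On the part of \<open>\<psi>\<close> that lives at scale
  \<open>16 ^ j\<close> the shear of squared size \<open>16 ^ (j - 1)\<close> is still negligible while the rescaled shear
  of squared size \<open>16 ^ (j + 2)\<close> already sees all of it, so the dilation has to see it too.\<close>

lemma shear_value_scale_step:
  fixes x :: real
  assumes "x > 0"
  defines "E \<equiv> \<lambda>t. Re (shift t (dilation 1 2 64)) - shear_value t"
  shows "shear_value (16 * x) - shear_value x \<le> (shear_value (256 * x) - shear_value (16 * x)) / 16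
    + 4 / 15 * (shear_value x - shear_value (x / 16)) + 6 * (E x - E (16 * x))"
proof -
  define \<tau> where "\<tau> = x / 16"
  have sq: "(sqrt \<tau>)\<^sup>2 = x / 16" "(64 * sqrt \<tau>)\<^sup>2 = 256 * x"
    using assms(1) by (simp_all add: \<tau>_def power_mult_distrib)
  let ?d = "increment_defect x (15 * x)"
  have 1: "15 * (shear_value (x + \<tau>) - shear_value x) \<le> shear_value x - shear_value (x / 16)"
    using shear_value_slope[of "x / 16" \<tau> 15 x] assms(1) by (simp add: \<tau>_def)
  have 2: "16 * (shear_value (272 * x) - shear_value (257 * x)) \<le> shear_value (256 * x) - shear_value (16 * x)"
    using shear_value_slope[of "16 * x" "15 * x" 16 "257 * x"] assms(1) by simp
  have "?d (column_shear 1 (sqrt \<tau>)) =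
      (shear_value (x + \<tau>) - shear_value x) - (shear_value (16 * x + \<tau>) - shear_value (16 * x))"
    using increment_defect_shear[of 1 x "15 * x" "sqrt \<tau>"] assms(1) unfolding sq by (simp add: \<tau>_def)
  also have "\<dots> \<le> shear_value (x + \<tau>) - shear_value x"
    using shear_value_mono[of "16 * x" "16 * x + \<tau>"] assms(1) by (simp add: \<tau>_def)
  finally have 3: "15 * ?d (column_shear 1 (sqrt \<tau>)) \<le> shear_value x - shear_value (x / 16)"
    using 1 by simp
  have 4: "?d (column_shear 1 (64 * sqrt \<tau>)) =
      (shear_value (16 * x) - shear_value x) - (shear_value (272 * x) - shear_value (257 * x))"
    using increment_defect_shear[of 1 x "15 * x" "64 * sqrt \<tau>"] assms(1) unfolding sq by simp
  have 5: "?d (dilation 1 2 64) = E x - E (16 * x)"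
    by (simp add: increment_defect_def E_def)
  have 6: "?d (column_shear 1 (64 * sqrt \<tau>)) \<le> 4 * ?d (column_shear 1 (sqrt \<tau>)) + 6 * ?d (dilation 1 2 64)"
    using assms(1) by (intro increment_defect_scaled_shear) auto
  show ?thesis
    using 2 3 6 unfolding 4 5 by (simp add: field_simps)
qed

lemma shear_value_bounded: "\<exists>M. \<forall>t\<ge>0. shear_value t \<le> M"
proof -
  obtain D where D: "\<And>t. t \<ge> 0 \<Longrightarrow> shear_value (4096 * t) \<le> 4 * shear_value t + D"
    using shear_value_scaled by blast
  define E where "E t = Re (shift t (dilation 1 2 64)) - shear_value t" for t
  have E: "E t \<ge> 0" if "t \<ge> 0" for t
    using Re_shift_ge[OF column_centralizer_dilation[of 1 2 64] that] by (simp add: E_def)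
  have sum: "shear_value (16 ^ Suc J) - shear_value 16 \<le> (shear_value (16 ^ Suc (Suc J)) - shear_value 256) / 16
      + 4 / 15 * (shear_value (16 ^ J) - shear_value 1) + 6 * (E 16 - E (16 ^ Suc J))" for J
  proof (induction J)
    case (Suc J)
    have eqs: "16 * 16 ^ Suc J = (16::real) ^ Suc (Suc J)" "256 * 16 ^ Suc J = (16::real) ^ Suc (Suc (Suc J))"
      "16 ^ Suc J / 16 = (16::real) ^ J" by simp_all
    have "(0::real) < 16 ^ Suc J" by simp
    from shear_value_scale_step[OF this, folded E_def, unfolded eqs]
    show ?case using Suc by (simp only: diff_divide_distrib ring_distribs)
  qed simp
  define M where "M = 3 * (shear_value 16 - shear_value 256 / 16 - 4 / 15 * shear_value 1 + D / 16 + 6 * E 16)"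
  have M: "shear_value (16 ^ Suc (Suc J)) \<le> M" for J
  proof -
    have pos: "(16 :: real) ^ k \<ge> 0" for k by simp
    have "shear_value (16 ^ Suc (Suc (Suc J))) \<le> 4 * shear_value (16 ^ J) + D"
      using D[OF pos[of J]] by (simp add: mult.assoc)
    moreover have "shear_value (16 ^ J) \<le> shear_value (16 ^ Suc (Suc J))"
      "shear_value (16 ^ Suc J) \<le> shear_value (16 ^ Suc (Suc J))"
      "shear_value 0 \<le> shear_value (16 ^ Suc (Suc J))"
      by (rule shear_value_mono; simp)+
    moreover have "0 \<le> shear_value 0"
      using negative_type
      by (simp add: shear_value_def shift_0 negative_type_def complex_nonneg_Reals_iff)
    moreover have "E (16 ^ Suc (Suc J)) \<ge> 0" using E pos by blast
    ultimately show ?thesis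
      using sum[of "Suc J"] unfolding M_def by argo
  qed
  have "shear_value t \<le> M" if "t \<ge> 0" for t
  proof -
    obtain J where "t < 16 ^ J" using real_arch_pow[of 16 t] by auto
    moreover have "(16::real) ^ J \<le> 16 ^ Suc (Suc J)" by simp
    ultimately have "t \<le> 16 ^ Suc (Suc J)" by linarith
    then show ?thesis using shear_value_mono[OF that] M[of J] by fastforce
  qed
  then show ?thesis by blast
qed

end

section \<open>Generation by transvections\<close>

lemma transvection_mult_right:
  assumes g: "g \<in> SL n"
  shows "(g \<cdot> transvection p q z) i j = g i j + (if j = q then g i p * z else 0)"
proof -
  obtain m where m: "n \<le> m" "i < m" "j < m" "p < m"
    by (rule that[of "Suc (n + p + i + j)"]) auto
  then have g: "g \<in> SL m" using g SL_mono[of n m] by auto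
  have "(g \<cdot> transvection p q z) i j = (\<Sum>k<m. g i k * transvection p q z k j)"
    using m SL_mult_eq[OF g, of "transvection p q z" i j] by simp
  also have "\<dots> = (\<Sum>k<m. (if k = j then g i j else 0) + (if k = p then if j = q then g i p * z else 0 else 0))"
    by (intro sum.cong refl) (auto simp: transvection_def distrib_left)
  also have "\<dots> = g i j + (if j = q then g i p * z else 0)"
    using m by (simp add: sum.distrib)
  finally show ?thesis .
qed

lemma SL_last_trivial:
  assumes g: "g \<in> SL (Suc n)" and "\<And>j. g n j = of_bool (n = j)" "\<And>i. g i n = of_bool (i = n)"
  shows "g \<in> SL n"
proof (rule SL_I)
  show "g i j = of_bool (i = j)" if "n \<le> i \<or> n \<le> j" for i j
    using that SL_outside[OF g, of i j] assms(2)[of j] assms(3)[of i] by (cases "i = n"; cases "j = n") auto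
  have eq: "block (Suc n) g = four_block_mat (block n g) (0\<^sub>m n 1) (0\<^sub>m 1 n) (1\<^sub>m 1)"
    by (rule eq_matI) (auto simp: block_def assms(2,3) four_block_mat_def less_Suc_eq)
  have "det (block (Suc n) g) = det (block n g) * det (1\<^sub>m 1 :: complex mat)"
    unfolding eq by (rule det_four_block_mat_upper_right_zero) auto
  then show "det (block n g) = 1" using SL_det[OF g] by simp
qed

lemma SL_subset_generated:
  assumes one: "\<one>\<^bsub>SL_inf\<^esub> \<in> S"
    and mult: "\<And>g h. \<lbrakk>g \<in> S; h \<in> S\<rbrakk> \<Longrightarrow> g \<cdot> h \<in> S"
    and trans: "\<And>p q z. p \<noteq> q \<Longrightarrow> transvection p q z \<in> S"
  shows "SL n \<subseteq> S"
proof (induction n)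
  case 0
  show ?case using one by (simp add: SL_0)
next
  case (Suc n)
  have left: "g \<in> S" if "p \<noteq> q" "g \<in> carrier SL_inf" "transvection p q z \<cdot> g \<in> S" for p q z g
  proof -
    have "transvection p q (- z) \<cdot> (transvection p q z \<cdot> g) = g"
      using that by (simp add: transvection_add flip: SLinf.m_assoc)
    then show ?thesis using mult[OF trans that(3), of p q "- z"] that(1) by simp
  qed
  have right: "g \<in> S" if "p \<noteq> q" "g \<in> carrier SL_inf" "g \<cdot> transvection p q z \<in> S" for p q z g
  proof -
    have "g \<cdot> transvection p q z \<cdot> transvection p q (- z) = g"
      using that by (simp add: transvection_add SLinf.m_assoc)
    then show ?thesis using mult[OF that(3) trans, of p q "- z"] that(1) by simp
  qed
  have row: "g \<in> S" if "g \<in> SL (Suc n)" "\<And>i. g i n = of_bool (i = n)" "\<And>j. m \<le> j \<Longrightarrow> j < n \<Longrightarrow> g n j = 0" for m g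
    using that
  proof (induction m arbitrary: g)
    case 0
    have r: "g n j = of_bool (n = j)" for j
      using 0 SL_outside[OF 0(1), of n j] by (cases "j < n"; cases "j = n") auto
    have "g \<in> SL n" by (rule SL_last_trivial[OF 0(1) r 0(2)])
    then show ?case using Suc.IH by blast
  next
    case (Suc m)
    show ?case
    proof (cases "m < n")
      case True
      let ?h = "g \<cdot> transvection n m (- g n m)"
      note h = transvection_mult_right[OF Suc.prems(1), of n m "- g n m"]
      have "?h \<in> SL (Suc n)"
        using True Suc.prems(1) by (intro SL_mult_closed transvection_SL) auto
      moreover have "?h i n = of_bool (i = n)" for i
        using True Suc.prems(2) by (simp add: h)
      moreover have "?h n j = 0" if "m \<le> j" "j < n" for j
        using that Suc.prems(2)[of n] Suc.prems(3)[of j] by (auto simp: h)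
      ultimately have "?h \<in> S" by (rule Suc.IH)
      then show ?thesis by (rule right[OF _ SL_inf_memI[OF Suc.prems(1)], rotated]) (use True in simp)
    next
      case False
      then show ?thesis using Suc.prems by (intro Suc.IH) auto
    qed
  qed
  have col: "g \<in> S" if "g \<in> SL (Suc n)" "g n n = 1" "\<And>i. m \<le> i \<Longrightarrow> i < n \<Longrightarrow> g i n = 0" for m g
    using that
  proof (induction m arbitrary: g)
    case 0
    have c: "g i n = of_bool (i = n)" for i
      using 0 SL_outside[OF 0(1), of i n] by (cases "i < n"; cases "i = n") auto
    show ?case by (rule row[OF 0(1) c, of n]) simp
  next
    case (Suc m)
    show ?case
    proof (cases "m < n")
      case True
      let ?h = "transvection m n (- g m n) \<cdot> g"
      have h: "?h = (\<lambda>i j. g i j + (if i = m then - g m n * g n j else 0))"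
        using True by (simp add: transvection_mult)
      have "?h \<in> SL (Suc n)"
        using True Suc.prems(1) by (intro SL_mult_closed transvection_SL) auto
      moreover have "?h n n = 1" using True Suc.prems(2) by (simp add: h)
      moreover have "?h i n = 0" if "m \<le> i" "i < n" for i
        using that Suc.prems(2) Suc.prems(3)[of i] by (auto simp: h)
      ultimately have "?h \<in> S" by (rule Suc.IH)
      then show ?thesis by (rule left[OF _ SL_inf_memI[OF Suc.prems(1)], rotated]) (use True in simp)
    next
      case False
      then show ?thesis using Suc.prems by (intro Suc.IH) auto
    qed
  qed
  have piv: "g \<in> S" if g: "g \<in> SL (Suc n)" "i < n" "g i n \<noteq> 0" for g i
  proof -
    let ?h = "transvection n i ((1 - g n n) / g i n) \<cdot> g"
    have h: "?h = (\<lambda>k j. g k j + (if k = n then (1 - g n n) / g i n * g i j else 0))"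
      using that by (simp add: transvection_mult)
    have "?h \<in> SL (Suc n)" using that by (intro SL_mult_closed transvection_SL) auto
    moreover have "?h n n = 1" using that by (simp add: h)
    ultimately have "?h \<in> S" by (rule col[of _ n]) simp
    then show ?thesis by (rule left[OF _ SL_inf_memI[OF g(1)], rotated]) (use g(2) in simp)
  qed
  show ?case
  proof
    fix g assume g: "g \<in> SL (Suc n)"
    show "g \<in> S"
    proof (cases "n = 0")
      case True
      then show ?thesis using g one by (simp add: SL_1)
    next
      case False
      show ?thesis
      proof (cases "\<exists>i<n. g i n \<noteq> 0")
        case True
        then show ?thesis using piv g by blast
      next
        case no: False
        obtain h where h: "h \<in> SL (Suc n)" "h \<cdot> g = \<one>\<^bsub>SL_inf\<^esub>"
          using SL_left_inverse[OF g] by metis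
        have "(\<Sum>k<Suc n. h n k * g k n) = 1"
          using SL_mult_eq[OF h(1), of g n n] unfolding h(2) by (simp add: SL_inf_simps)
        then have "h n n * g n n = 1" using no by simp
        then have gn: "g n n \<noteq> 0" by auto
        let ?h = "transvection 0 n 1 \<cdot> g"
        have "?h \<in> SL (Suc n)" using False g by (intro SL_mult_closed transvection_SL) auto
        moreover have "?h 0 n \<noteq> 0" using False no gn by (simp add: transvection_mult)
        ultimately have "?h \<in> S" using False by (intro piv[of _ 0]) auto
        then show ?thesis by (rule left[OF _ SL_inf_memI[OF g], rotated]) (use False in simp)
      qed
    qed
  qed
qed

context spherical_negative_type
begin

definition shear_limit :: real where
  "shear_limit = (SUP t\<in>{0..}. shear_value t)"

lemma shear_value_le: "t \<ge> 0 \<Longrightarrow> shear_value t \<le> shear_limit"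
  unfolding shear_limit_def using shear_value_bounded by (intro cSUP_upper) (auto simp: bdd_above_def)

lemma shear_value_tendsto: "(shear_value \<longlongrightarrow> shear_limit) at_top"
proof (rule order_tendstoI)
  fix a assume "a < shear_limit"
  then obtain t where t: "t \<ge> 0" "a < shear_value t"
    unfolding shear_limit_def using shear_value_bounded
    by (subst (asm) less_cSUP_iff) (auto simp: bdd_above_def)
  show "\<forall>\<^sub>F x in at_top. a < shear_value x"
    by (rule eventually_mono[OF eventually_ge_at_top[of t]]) (use t shear_value_mono less_le_trans in blast)
next
  fix a assume "shear_limit < a"
  show "\<forall>\<^sub>F x in at_top. shear_value x < a"
    by (rule eventually_mono[OF eventually_ge_at_top[of 0]]) (use \<open>shear_limit < a\<close> shear_value_le le_less_trans in blast)
qed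

lemma shear_value_square_tendsto: "((\<lambda>s. shear_value (2 * s\<^sup>2)) \<longlongrightarrow> shear_limit) at_top"
proof (rule filterlim_compose[OF shear_value_tendsto])
  show "filterlim (\<lambda>s::real. 2 * s\<^sup>2) at_top at_top"
    by (intro filterlim_tendsto_pos_mult_at_top[OF tendsto_const] filterlim_pow_at_top filterlim_ident) auto
qed

definition displacement :: "real \<Rightarrow> infmat \<Rightarrow> complex" where
  "displacement s g = far_kernel s g s - shear_value (2 * s\<^sup>2)"

abbreviation far_pair_kernel :: "infmat \<times> real \<Rightarrow> infmat \<times> real \<Rightarrow> complex" where
  "far_pair_kernel \<equiv> (\<lambda>(g, s) (h, r). far_kernel s (inv\<^bsub>SL_inf\<^esub> h \<cdot> g) r)"

lemma displacement_dist:
  assumes "g \<in> carrier SL_inf" "h \<in> carrier SL_inf"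
  shows "kernel_dist far_pair_kernel (g, s) (h, s) = 2 * Re (displacement s (inv\<^bsub>SL_inf\<^esub> h \<cdot> g))"
  using assms by (simp add: kernel_dist_def displacement_def far_kernel_shift column_centralizer_one shift_one)

lemma far_dist:
  assumes "g \<in> carrier SL_inf" "0 \<le> r" "r \<le> s"
  shows "kernel_dist far_pair_kernel (g, s) (g, r) \<le> 2 * (shear_limit - shear_value (2 * r\<^sup>2))"
    "kernel_dist far_pair_kernel (g, r) (g, s) \<le> 2 * (shear_limit - shear_value (2 * r\<^sup>2))"
proof -
  have "shear_value (s\<^sup>2 + r\<^sup>2) \<le> shear_limit" by (intro shear_value_le) auto
  moreover have "shear_value (2 * r\<^sup>2) \<le> shear_value (2 * s\<^sup>2)"
    using assms by (intro shear_value_mono) auto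
  ultimately show "kernel_dist far_pair_kernel (g, s) (g, r) \<le> 2 * (shear_limit - shear_value (2 * r\<^sup>2))"
    "kernel_dist far_pair_kernel (g, r) (g, s) \<le> 2 * (shear_limit - shear_value (2 * r\<^sup>2))"
    using assms by (simp_all add: kernel_dist_def far_kernel_shift column_centralizer_one shift_one add.commute)
qed

lemma displacement_nonneg: "g \<in> carrier SL_inf \<Longrightarrow> 0 \<le> Re (displacement s g)"
  using kernel_dist_nonneg[OF far_kernel_cond_negative, of "(g, s)" "(\<one>\<^bsub>SL_inf\<^esub>, s)"] displacement_dist[of g "\<one>\<^bsub>SL_inf\<^esub>" s]
  by simp

lemma displacement_inv: "g \<in> carrier SL_inf \<Longrightarrow> displacement s (inv\<^bsub>SL_inf\<^esub> g) = cnj (displacement s g)"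
  by (simp add: displacement_def far_kernel_herm)

lemma displacement_mult:
  assumes [simp]: "g \<in> carrier SL_inf" "h \<in> carrier SL_inf"
  shows "Re (displacement s (g \<cdot> h)) \<le> 2 * Re (displacement s g) + 2 * Re (displacement s h)"
    "\<bar>Im (displacement s (g \<cdot> h)) - Im (displacement s g) - Im (displacement s h)\<bar>
      \<le> Re (displacement s g) + Re (displacement s h)"
proof -
  have *: "inv\<^bsub>SL_inf\<^esub> g \<cdot> (g \<cdot> h) = h" by (simp flip: SLinf.m_assoc)
  show "Re (displacement s (g \<cdot> h)) \<le> 2 * Re (displacement s g) + 2 * Re (displacement s h)"
    using kernel_dist_triangle[OF far_kernel_cond_negative, of "(g \<cdot> h, s)" "(g, s)" "(\<one>\<^bsub>SL_inf\<^esub>, s)"]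
    by (simp add: displacement_dist *)
  show "\<bar>Im (displacement s (g \<cdot> h)) - Im (displacement s g) - Im (displacement s h)\<bar>
      \<le> Re (displacement s g) + Re (displacement s h)"
    using kernel_dist_Im[OF far_kernel_cond_negative, of "(g \<cdot> h, s)" "(g, s)" "(\<one>\<^bsub>SL_inf\<^esub>, s)"]
    by (simp add: displacement_dist *) (simp add: displacement_def abs_minus_commute algebra_simps)
qed

lemma displacement_compare:
  assumes [simp]: "g \<in> carrier SL_inf" and r: "0 \<le> r" "r \<le> s"
  shows "Re (displacement s g) \<le> 6 * (shear_limit - shear_value (2 * r\<^sup>2)) + 4 * Re (displacement r g)"
proof -
  note K = kernel_dist_triangle[OF far_kernel_cond_negative]
  let ?d = "kernel_dist far_pair_kernel" and ?e = "\<one>\<^bsub>SL_inf\<^esub>"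
  have "?d (g, s) (?e, s) \<le> 2 * ?d (g, s) (g, r) + 2 * ?d (g, r) (?e, s)" by (rule K) auto
  moreover have "?d (g, r) (?e, s) \<le> 2 * ?d (g, r) (?e, r) + 2 * ?d (?e, r) (?e, s)" by (rule K) auto
  ultimately show ?thesis
    using far_dist(1)[OF assms] far_dist(2)[OF SLinf.one_closed r]
    by (simp add: displacement_dist)
qed

end

section \<open>Mautner's argument\<close>

lemma continuous_map_SL:
  assumes "continuous_map SL_inf_topology euclidean f"
  shows "continuous_on (SL n) f"
proof -
  have "continuous_map (top_of_set (SL n)) SL_inf_topology (\<lambda>g. g)"
    unfolding continuous_map_def
    by (auto simp: topspace_SL_inf_topology SL_inf_memI openin_SL_inf_topology Int_def conj_commute)
  from continuous_map_compose[OF this assms] show ?thesis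
    by (simp add: o_def)
qed

locale continuous_spherical_negative_type = spherical_negative_type +
  assumes continuous: "continuous_map SL_inf_topology euclidean \<psi>"
begin

definition vanishing_displacement :: "infmat set" where
  "vanishing_displacement = {g \<in> carrier SL_inf. ((\<lambda>s. Re (displacement s g)) \<longlongrightarrow> 0) at_top}"

lemma vanishing_displacement_carrier: "g \<in> vanishing_displacement \<Longrightarrow> g \<in> carrier SL_inf"
  by (simp add: vanishing_displacement_def)

lemma vanishing_displacementD:
  "\<lbrakk>g \<in> vanishing_displacement; 0 < \<delta>\<rbrakk> \<Longrightarrow> \<forall>\<^sub>F s in at_top. Re (displacement s g) < \<delta>"
  by (auto simp: vanishing_displacement_def dest: order_tendstoD)

lemma vanishing_displacementI:
  assumes g: "g \<in> carrier SL_inf"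
    and "\<And>\<delta>. 0 < \<delta> \<Longrightarrow> \<forall>\<^sub>F s in at_top. Re (displacement s g) < C * \<delta>" and C: "C > 0"
  shows "g \<in> vanishing_displacement"
proof -
  have "((\<lambda>s. Re (displacement s g)) \<longlongrightarrow> 0) at_top"
  proof (rule order_tendstoI)
    fix a :: real assume "0 < a"
    then show "\<forall>\<^sub>F s in at_top. Re (displacement s g) < a"
      using assms(2)[of "a / C"] C by simp
  qed (use displacement_nonneg[OF g] less_le_trans in \<open>auto intro!: always_eventually\<close>)
  then show ?thesis using g by (simp add: vanishing_displacement_def)
qed

lemma vanishing_displacement_mult:
  assumes "g \<in> vanishing_displacement" "h \<in> vanishing_displacement"
  shows "g \<cdot> h \<in> vanishing_displacement"
proof (rule vanishing_displacementI[where C = 4])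
  note [simp] = assms[THEN vanishing_displacement_carrier]
  show "\<forall>\<^sub>F s in at_top. Re (displacement s (g \<cdot> h)) < 4 * \<delta>" if "\<delta> > 0" for \<delta>
    using vanishing_displacementD[OF assms(1) that] vanishing_displacementD[OF assms(2) that]
  proof eventually_elim
    case (elim s)
    then show ?case using displacement_mult(1)[of g h s] by simp
  qed
qed (use assms in \<open>auto dest: vanishing_displacement_carrier\<close>)

lemma vanishing_displacement_inv:
  "g \<in> vanishing_displacement \<Longrightarrow> inv\<^bsub>SL_inf\<^esub> g \<in> vanishing_displacement"
  by (simp add: vanishing_displacement_def displacement_inv)

lemma vanishing_displacement_SU:
  assumes "k \<in> SU_inf" "k \<in> column_centralizer"
  shows "k \<in> vanishing_displacement"
proof -
  have k: "k \<in> carrier SL_inf" using assms(1) by (rule SU_inf_carrier)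
  note n = rk[OF k]
  have "displacement s k = 0" for s
  proof -
    have "far_kernel s k s = \<psi> (k \<cdot> column_shear (rk k) (sqrt (2 * s\<^sup>2)))"
      using far_kernel_shift[OF assms(2)] by (simp add: shift_def)
    also have "\<dots> = \<psi> (\<one>\<^bsub>SL_inf\<^esub> \<cdot> column_shear (rk k) (sqrt (2 * s\<^sup>2)))"
      using left_invariant[OF assms(1)] n(1) by simp
    also have "\<dots> = shift (2 * s\<^sup>2) \<one>\<^bsub>SL_inf\<^esub>"
      using shift_single[OF SL_one[of 1], of "rk k" "sqrt (2 * s\<^sup>2)"] n(1) by simp
    finally show ?thesis by (simp add: displacement_def shift_one)
  qed
  then show ?thesis using k by (simp add: vanishing_displacement_def)
qed

lemma vanishing_displacement_real_shear:
  assumes "i > 0"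
  shows "column_shear i v \<in> vanishing_displacement"
proof -
  have "displacement s (column_shear i v) = shear_value (2 * s\<^sup>2 + v\<^sup>2) - shear_value (2 * s\<^sup>2)" for s
    using assms
    by (simp add: displacement_def far_kernel_shift column_centralizer_shear shift_column_shear)
  then have d: "Re (displacement s (column_shear i v)) = shear_value (2 * s\<^sup>2 + v\<^sup>2) - shear_value (2 * s\<^sup>2)" for s
    by simp
  have "((\<lambda>s. shear_value (2 * s\<^sup>2 + v\<^sup>2) - shear_value (2 * s\<^sup>2)) \<longlongrightarrow> 0) at_top"
  proof (rule tendsto_sandwich[where f = "\<lambda>_. 0"
        and h = "\<lambda>s. shear_limit - shear_value (2 * s\<^sup>2)", OF always_eventually always_eventually])
    show "((\<lambda>s. shear_limit - shear_value (2 * s\<^sup>2)) \<longlongrightarrow> 0) at_top"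
      using tendsto_diff[OF tendsto_const shear_value_square_tendsto, of shear_limit] by simp
  qed (auto intro!: shear_value_mono shear_value_le)
  then show ?thesis
    using assms by (simp add: vanishing_displacement_def d)
qed

lemma vanishing_displacement_shear:
  assumes "i > 0"
  shows "transvection i 0 z \<in> vanishing_displacement"
proof (cases "z = 0")
  case True
  then show ?thesis using vanishing_displacement_real_shear[OF assms, of 0] by simp
next
  case False
  define w where "w = z / cmod z"
  define D where "D = dilation i (Suc i) w"
  have w: "cmod w = 1" "w \<noteq> 0" "w * cmod z = z" using False by (simp_all add: w_def norm_divide)
  have D: "D \<in> vanishing_displacement"
    unfolding D_def using assms w
    by (intro vanishing_displacement_SU dilation_SU column_centralizer_dilation) auto
  note Dc [simp] = vanishing_displacement_carrier[OF D]
  have "D \<cdot> column_shear i (cmod z) = transvection i 0 z \<cdot> D"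
    unfolding D_def using dilation_transvection[of i "Suc i" 0 w "cmod z"] assms w by simp
  then have "D \<cdot> column_shear i (cmod z) \<cdot> inv\<^bsub>SL_inf\<^esub> D = transvection i 0 z"
    using assms by (simp add: SLinf.m_assoc)
  then show ?thesis
    using D assms vanishing_displacement_mult vanishing_displacement_inv vanishing_displacement_real_shear by metis
qed

lemma continuous_on_entries:
  fixes \<gamma> :: "real \<Rightarrow> infmat"
  assumes "\<And>e. \<gamma> e \<in> SL n" "\<And>i j. continuous_on UNIV (\<lambda>e. \<gamma> e i j)"
  shows "continuous_on UNIV (\<lambda>e. \<psi> (\<gamma> e))"
proof (rule continuous_on_compose2[OF continuous_map_SL[OF continuous, of n]])
  show "continuous_on UNIV \<gamma>"
    using assms(2) by (intro continuous_on_coordinatewise_then_product) auto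
qed (use assms(1) in auto)

lemma displacement_row_shear_tendsto:
  assumes "j > 0"
  shows "((\<lambda>e. Re (displacement r (transvection 0 j (of_real e * z)))) \<longlongrightarrow> 0) (at_right 0)"
proof -
  let ?n = "Suc (Suc (Suc j))"
  define \<gamma> where "\<gamma> e = column_shear (Suc (Suc j)) (- r) \<cdot>
    (transvection 0 j (of_real e * z) \<cdot> column_shear (Suc j) r)" for e :: real
  have SL: "\<gamma> e \<in> SL ?n" for e
    unfolding \<gamma>_def using assms by (intro SL_mult_closed transvection_SL) auto
  have far: "far_kernel r (transvection 0 j (of_real e * z)) r = \<psi> (\<gamma> e)" for e
    unfolding \<gamma>_def using assms transvection_SL[of 0 "Suc j" j "of_real e * z"]
    by (intro far_kernel_eq[of _ "Suc j"]) auto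
  have "continuous_on UNIV (\<lambda>e. \<psi> (\<gamma> e))"
  proof (rule continuous_on_entries[OF SL])
    fix i k
    have "\<gamma> e i k = column_shear (Suc j) r i k
        + (if i = 0 then of_real e * z * column_shear (Suc j) r j k else 0)
        + (if i = Suc (Suc j) then - r * (column_shear (Suc j) r 0 k
          + of_real e * z * column_shear (Suc j) r j k) else 0)" for e
      unfolding \<gamma>_def using assms by (simp add: transvection_mult)
    then show "continuous_on UNIV (\<lambda>e. \<gamma> e i k)"
      by (cases "i = 0"; cases "i = Suc (Suc j)") (auto intro!: continuous_intros)
  qed
  then have "((\<lambda>e. displacement r (transvection 0 j (of_real e * z))) \<longlongrightarrow>
      displacement r (transvection 0 j (of_real 0 * z))) (at_right 0)"
    unfolding displacement_def far continuous_on_def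
    by (intro tendsto_diff tendsto_const) (auto intro: tendsto_within_subset)
  then show ?thesis
    using tendsto_Re by (fastforce simp: displacement_def far_kernel_shift column_centralizer_one shift_one)
qed

lemma displacement_row_shear_small:
  assumes j: "j > 0" and \<delta>: "\<delta> > 0"
  shows "\<forall>\<^sub>F e in at_right 0. \<forall>\<^sub>F s in at_top. Re (displacement s (transvection 0 j (of_real e * z))) < \<delta>"
proof -
  have "\<forall>\<^sub>F r in at_top. shear_limit - \<delta> / 12 < shear_value (2 * r\<^sup>2) \<and> r \<ge> 0"
    using order_tendstoD(1)[OF shear_value_square_tendsto, of "shear_limit - \<delta> / 12"] \<delta>
    by (simp add: eventually_conj_iff eventually_ge_at_top)
  then obtain r where r: "shear_limit - \<delta> / 12 < shear_value (2 * r\<^sup>2)" "r \<ge> 0"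
    by (rule eventually_happens'[rotated, THEN exE]) auto
  have "\<forall>\<^sub>F e in at_right 0. Re (displacement r (transvection 0 j (of_real e * z))) < \<delta> / 8"
    using order_tendstoD(2)[OF displacement_row_shear_tendsto[OF j], of "\<delta> / 8"] \<delta> by simp
  then show ?thesis
  proof eventually_elim
    case (elim e)
    show ?case
    proof (rule eventually_mono[OF eventually_ge_at_top[of r]])
      fix s assume "r \<le> s"
      then show "Re (displacement s (transvection 0 j (of_real e * z))) < \<delta>"
        using displacement_compare[OF transvection_carrier r(2), of 0 j s "of_real e * z"] j elim r(1) by simp
    qed
  qed
qed

text \<open>Mautner's argument: a diagonal element is a product of column shears and of row shears
  that can be chosen arbitrarily close to the identity.\<close>

lemma vanishing_displacement_dilation:
  assumes j: "j > 0" and \<sigma>: "\<sigma> > 0"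
  shows "dilation 0 j (complex_of_real \<sigma>) \<in> vanishing_displacement"
proof (rule vanishing_displacementI[where C = 22])
  fix \<delta> :: real assume \<delta>: "\<delta> > 0"
  have "\<forall>\<^sub>F e in at_right 0. (\<forall>\<^sub>F s in at_top. Re (displacement s (transvection 0 j (of_real e * 1))) < \<delta>) \<and>
      (\<forall>\<^sub>F s in at_top. Re (displacement s (transvection 0 j (of_real e * - (1 / of_real \<sigma>)))) < \<delta>) \<and> e > 0"
    by (intro eventually_conj displacement_row_shear_small[OF j \<delta>] eventually_at_right_less)
  then obtain e where e: "\<forall>\<^sub>F s in at_top. Re (displacement s (transvection 0 j (of_real e * 1))) < \<delta>"
      "\<forall>\<^sub>F s in at_top. Re (displacement s (transvection 0 j (of_real e * - (1 / of_real \<sigma>)))) < \<delta>" "e > 0"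
    by (rule eventually_happens'[rotated, THEN exE]) auto
  define x y where "x = (inverse (of_real \<sigma>) - 1) / complex_of_real e" and "y = (of_real \<sigma> - 1) / complex_of_real e"
  have dil: "dilation 0 j (complex_of_real \<sigma>) = transvection j 0 x \<cdot> (transvection 0 j (of_real e * 1) \<cdot>
      (transvection j 0 y \<cdot> transvection 0 j (of_real e * - (1 / of_real \<sigma>))))"
    using dilation_eq[of 0 j "of_real \<sigma>" "of_real e"] j \<sigma> e(3) by (simp add: x_def y_def)
  show "\<forall>\<^sub>F s in at_top. Re (displacement s (dilation 0 j (complex_of_real \<sigma>))) < 22 * \<delta>"
    using e(1,2) vanishing_displacementD[OF vanishing_displacement_shear[OF j] \<delta>, of x]
      vanishing_displacementD[OF vanishing_displacement_shear[OF j] \<delta>, of y]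
  proof eventually_elim
    case (elim s)
    let ?A = "transvection j 0 x" and ?B = "transvection 0 j (of_real e * 1)"
    let ?C = "transvection j 0 y" and ?D = "transvection 0 j (of_real e * - (1 / complex_of_real \<sigma>))"
    have "Re (displacement s (?A \<cdot> (?B \<cdot> (?C \<cdot> ?D)))) \<le> 2 * Re (displacement s ?A) + 2 * Re (displacement s (?B \<cdot> (?C \<cdot> ?D)))"
      "Re (displacement s (?B \<cdot> (?C \<cdot> ?D))) \<le> 2 * Re (displacement s ?B) + 2 * Re (displacement s (?C \<cdot> ?D))"
      "Re (displacement s (?C \<cdot> ?D)) \<le> 2 * Re (displacement s ?C) + 2 * Re (displacement s ?D)"
      using j by (intro displacement_mult; simp)+
    then show ?case unfolding dil using elim by linarith
  qed
qed (use j \<sigma> in \<open>auto intro: dilation_carrier\<close>)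

lemma vanishing_displacement_row_shear:
  assumes j: "j > 0"
  shows "transvection 0 j z \<in> vanishing_displacement"
proof (rule vanishing_displacementI[where C = 10])
  fix \<delta> :: real assume \<delta>: "\<delta> > 0"
  have "\<forall>\<^sub>F e in at_right 0. (\<forall>\<^sub>F s in at_top. Re (displacement s (transvection 0 j (of_real e * z))) < \<delta>) \<and> e > 0"
    by (intro eventually_conj displacement_row_shear_small[OF j \<delta>] eventually_at_right_less)
  then obtain e where e: "\<forall>\<^sub>F s in at_top. Re (displacement s (transvection 0 j (of_real e * z))) < \<delta>" "e > 0"
    by (rule eventually_happens'[rotated, THEN exE]) auto
  define \<sigma> where "\<sigma> = 1 / sqrt e"
  have \<sigma>: "\<sigma> > 0" "\<sigma>\<^sup>2 * e = 1" using e(2) by (simp_all add: \<sigma>_def power_divide)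
  define D where "D = dilation 0 j (complex_of_real \<sigma>)"
  have D: "D \<in> vanishing_displacement" unfolding D_def using j \<sigma>(1) by (rule vanishing_displacement_dilation)
  note [simp] = vanishing_displacement_carrier[OF D]
  let ?T = "transvection 0 j (of_real e * z)"
  have "(complex_of_real \<sigma>)\<^sup>2 * of_real e = 1"
    using \<sigma>(2) by (metis of_real_1 of_real_mult of_real_power)
  then have "D \<cdot> ?T = transvection 0 j z \<cdot> D"
    unfolding D_def using dilation_transvection2[of 0 j "of_real \<sigma>" "of_real e * z"] j \<sigma>(1)
    by (simp flip: mult.assoc)
  then have "D \<cdot> ?T \<cdot> inv\<^bsub>SL_inf\<^esub> D = transvection 0 j z"
    using j by (simp add: SLinf.m_assoc)
  then have T: "transvection 0 j z = D \<cdot> (?T \<cdot> inv\<^bsub>SL_inf\<^esub> D)" using j by (simp add: SLinf.m_assoc)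
  show "\<forall>\<^sub>F s in at_top. Re (displacement s (transvection 0 j z)) < 10 * \<delta>"
    using e(1) vanishing_displacementD[OF D \<delta>]
  proof eventually_elim
    case (elim s)
    have "Re (displacement s (D \<cdot> (?T \<cdot> inv\<^bsub>SL_inf\<^esub> D))) \<le> 2 * Re (displacement s D) + 2 * Re (displacement s (?T \<cdot> inv\<^bsub>SL_inf\<^esub> D))"
      "Re (displacement s (?T \<cdot> inv\<^bsub>SL_inf\<^esub> D)) \<le> 2 * Re (displacement s ?T) + 2 * Re (displacement s (inv\<^bsub>SL_inf\<^esub> D))"
      using j by (intro displacement_mult; simp)+
    then show ?case unfolding T using elim by (simp add: displacement_inv)
  qed
qed (use j in auto)

lemma transvection_commutator':
  assumes "i \<noteq> j" "i \<noteq> k" "j \<noteq> k"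
  shows "transvection i j z = transvection i k z \<cdot> transvection k j 1 \<cdot>
    inv\<^bsub>SL_inf\<^esub> (transvection k j 1 \<cdot> transvection i k z)"
  using transvection_commutator[OF assms, of z 1] assms by (simp add: SLinf.m_assoc)

lemma vanishing_displacement_transvection:
  assumes "p \<noteq> q"
  shows "transvection p q z \<in> vanishing_displacement"
proof (cases "p = 0 \<or> q = 0")
  case True
  then show ?thesis
    using assms vanishing_displacement_shear vanishing_displacement_row_shear by auto
next
  case False
  then show ?thesis
    using assms
    by (subst transvection_commutator'[of p q 0])
      (auto intro!: vanishing_displacement_mult vanishing_displacement_inv
        vanishing_displacement_shear vanishing_displacement_row_shear)
qed

lemma Im_displacement_additive:
  assumes "g \<in> vanishing_displacement" "h \<in> vanishing_displacement"
  shows "((\<lambda>s. Im (displacement s (g \<cdot> h)) - Im (displacement s g) - Im (displacement s h)) \<longlongrightarrow> 0) at_top"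
proof (rule tendsto_0_le[where K = 1])
  show "((\<lambda>s. Re (displacement s g) + Re (displacement s h)) \<longlongrightarrow> 0) at_top"
    using assms tendsto_add[of "\<lambda>s. Re (displacement s g)" 0 at_top "\<lambda>s. Re (displacement s h)" 0]
    by (simp add: vanishing_displacement_def)
  have "\<bar>Im (displacement s (g \<cdot> h)) - Im (displacement s g) - Im (displacement s h)\<bar>
      \<le> Re (displacement s g) + Re (displacement s h)" for s
    using assms by (intro displacement_mult(2)) (auto dest: vanishing_displacement_carrier)
  then show "\<forall>\<^sub>F s in at_top. norm (Im (displacement s (g \<cdot> h)) - Im (displacement s g) - Im (displacement s h))
      \<le> norm (Re (displacement s g) + Re (displacement s h)) * 1"
    by (intro always_eventually) (simp, metis abs_ge_self order_trans)
qed

lemma Im_displacement_commutator: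
  assumes g: "g \<in> vanishing_displacement" and h: "h \<in> vanishing_displacement"
  shows "((\<lambda>s. Im (displacement s (g \<cdot> h \<cdot> inv\<^bsub>SL_inf\<^esub> (h \<cdot> g)))) \<longlongrightarrow> 0) at_top"
proof -
  note hg = vanishing_displacement_mult[OF h g] and gh = vanishing_displacement_mult[OF g h]
  have "((\<lambda>s. (Im (displacement s (g \<cdot> h \<cdot> inv\<^bsub>SL_inf\<^esub> (h \<cdot> g)))
        - Im (displacement s (g \<cdot> h)) - Im (displacement s (inv\<^bsub>SL_inf\<^esub> (h \<cdot> g))))
      + (Im (displacement s (g \<cdot> h)) - Im (displacement s g) - Im (displacement s h))
      - (Im (displacement s (h \<cdot> g)) - Im (displacement s h) - Im (displacement s g))) \<longlongrightarrow> 0 + 0 - 0) at_top"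
    by (intro tendsto_add tendsto_diff Im_displacement_additive g h gh vanishing_displacement_inv[OF hg])
  then show ?thesis
    using vanishing_displacement_carrier[OF hg] by (simp add: displacement_inv)
qed

lemma displacement_tendsto_0:
  assumes "g \<in> carrier SL_inf"
  shows "((\<lambda>s. displacement s g) \<longlongrightarrow> 0) at_top"
proof -
  let ?S = "{g \<in> vanishing_displacement. ((\<lambda>s. Im (displacement s g)) \<longlongrightarrow> 0) at_top}"
  obtain n where "g \<in> SL n" using assms by (rule SL_inf_memE)
  also have "SL n \<subseteq> ?S"
  proof (rule SL_subset_generated)
    show "\<one>\<^bsub>SL_inf\<^esub> \<in> ?S"
      by (simp add: vanishing_displacement_def displacement_def far_kernel_shift column_centralizer_one shift_one)
    show "g \<cdot> h \<in> ?S" if "g \<in> ?S" "h \<in> ?S" for g h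
    proof -
      have "((\<lambda>s. (Im (displacement s (g \<cdot> h)) - Im (displacement s g) - Im (displacement s h))
          + Im (displacement s g) + Im (displacement s h)) \<longlongrightarrow> 0 + 0 + 0) at_top"
        using that by (intro tendsto_add Im_displacement_additive) auto
      then show ?thesis using that by (simp add: vanishing_displacement_mult)
    qed
    show "transvection p q z \<in> ?S" if "p \<noteq> q" for p q z
    proof -
      have "((\<lambda>s. Im (displacement s (transvection p q z))) \<longlongrightarrow> 0) at_top"
        unfolding transvection_commutator'[OF that, of "Suc (p + q)" z, simplified]
        using that by (intro Im_displacement_commutator vanishing_displacement_transvection) auto
      then show ?thesis using that by (simp add: vanishing_displacement_transvection)
    qed
  qed
  finally have "((\<lambda>s. Re (displacement s g)) \<longlongrightarrow> 0) at_top" "((\<lambda>s. Im (displacement s g)) \<longlongrightarrow> 0) at_top"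
    by (auto simp: vanishing_displacement_def)
  from tendsto_Complex[OF this] show ?thesis by (simp add: zero_complex.code complex_surj)
qed

end

section \<open>The function of positive type\<close>

lemma conjugate_in_column_centralizer:
  assumes g: "g \<in> SL n" and n: "n > 0"
  defines "k \<equiv> rotation n 0 0 1"
  shows "k \<cdot> g \<cdot> inv\<^bsub>SL_inf\<^esub> k \<in> column_centralizer"
proof (rule column_centralizerI[of _ n])
  note gc [simp] = SL_inf_memI[OF g]
  have [simp]: "k \<in> carrier SL_inf" unfolding k_def using n by (intro rotation_carrier) auto
  show "k \<cdot> g \<cdot> inv\<^bsub>SL_inf\<^esub> k \<in> carrier SL_inf" by simp
  fix p s assume p: "p > n"
  let ?E = "transvection p n (complex_of_real s)" and ?T = "column_shear p s"
  have [simp]: "?E \<in> carrier SL_inf" "?T \<in> carrier SL_inf" using p by auto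
  have kE: "k \<cdot> ?E = ?T \<cdot> k" unfolding k_def using p n by (intro quarter_turn_column) auto
  have "?E \<cdot> inv\<^bsub>SL_inf\<^esub> k = inv\<^bsub>SL_inf\<^esub> k \<cdot> (k \<cdot> ?E) \<cdot> inv\<^bsub>SL_inf\<^esub> k"
    by (simp flip: SLinf.m_assoc)
  also have "\<dots> = inv\<^bsub>SL_inf\<^esub> k \<cdot> ?T"
    unfolding kE by (simp add: SLinf.m_assoc)
  finally have Ek: "?E \<cdot> inv\<^bsub>SL_inf\<^esub> k = inv\<^bsub>SL_inf\<^esub> k \<cdot> ?T" .
  have gE: "g \<cdot> ?E = ?E \<cdot> g" using p by (intro transvection_SL_commute[OF g]) auto
  have "k \<cdot> g \<cdot> inv\<^bsub>SL_inf\<^esub> k \<cdot> ?T = k \<cdot> (g \<cdot> (inv\<^bsub>SL_inf\<^esub> k \<cdot> ?T))" by (simp add: SLinf.m_assoc)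
  also have "\<dots> = k \<cdot> (g \<cdot> ?E \<cdot> inv\<^bsub>SL_inf\<^esub> k)" by (simp add: SLinf.m_assoc flip: Ek)
  also have "\<dots> = k \<cdot> ?E \<cdot> g \<cdot> inv\<^bsub>SL_inf\<^esub> k" by (simp add: SLinf.m_assoc gE)
  also have "\<dots> = ?T \<cdot> (k \<cdot> g \<cdot> inv\<^bsub>SL_inf\<^esub> k)" by (simp add: SLinf.m_assoc kE)
  finally show "k \<cdot> g \<cdot> inv\<^bsub>SL_inf\<^esub> k \<cdot> ?T = ?T \<cdot> (k \<cdot> g \<cdot> inv\<^bsub>SL_inf\<^esub> k)" .
qed

context continuous_spherical_negative_type
begin

lemma shift_tendsto_shear_limit:
  assumes "g \<in> column_centralizer"
  shows "((\<lambda>s. shift (2 * s\<^sup>2) g) \<longlongrightarrow> of_real shear_limit) at_top"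
proof -
  have "((\<lambda>s. displacement s g + of_real (shear_value (2 * s\<^sup>2))) \<longlongrightarrow> 0 + of_real shear_limit) at_top"
    using assms by (intro tendsto_add tendsto_of_real displacement_tendsto_0 shear_value_square_tendsto)
      (rule column_centralizer_carrier)
  then show ?thesis using assms by (simp add: displacement_def far_kernel_shift)
qed

lemma positive_type_shear_limit: "positive_type SL_inf (\<lambda>g. of_real shear_limit - \<psi> g)"
  unfolding positive_type_def
proof (intro allI impI)
  fix N :: nat and g :: "nat \<Rightarrow> infmat" and c :: "nat \<Rightarrow> complex"
  assume "\<forall>i<N. g i \<in> carrier SL_inf"
  then have gc [simp]: "g i \<in> carrier SL_inf" if "i < N" for i using that by blast
  obtain n where n: "n > 0" "g ` {..<N} \<subseteq> SL n"
    using subset_SL_common[of "g ` {..<N}"] gc by blast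
  define k where "k = rotation n 0 0 1"
  have kSU: "k \<in> SU_inf" unfolding k_def using n(1) by (intro rotation_SU) auto
  have k [simp]: "k \<in> carrier SL_inf" using kSU by (rule SU_inf_carrier)
  define h where "h i = k \<cdot> g i \<cdot> inv\<^bsub>SL_inf\<^esub> k" for i
  have h: "h i \<in> column_centralizer" if "i < N" for i
    unfolding h_def k_def using n that by (intro conjugate_in_column_centralizer) auto
  define hh where "hh i j = inv\<^bsub>SL_inf\<^esub> (h j) \<cdot> h i" for i j
  have hh: "hh i j \<in> column_centralizer" if "i < N" "j < N" for i j
    unfolding hh_def using h that by (intro column_centralizer_mult column_centralizer_inv) auto
  have \<psi>hh: "\<psi> (hh i j) = \<psi> (inv\<^bsub>SL_inf\<^esub> (g j) \<cdot> g i)" if "i < N" "j < N" for i j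
  proof -
    have cancel: "inv\<^bsub>SL_inf\<^esub> k \<cdot> (k \<cdot> x) = x" if "x \<in> carrier SL_inf" for x
      using that by (simp flip: SLinf.m_assoc)
    have "hh i j = k \<cdot> (inv\<^bsub>SL_inf\<^esub> (g j) \<cdot> (g i \<cdot> inv\<^bsub>SL_inf\<^esub> k))"
      unfolding hh_def h_def using that by (simp add: SLinf.inv_mult_group SLinf.m_assoc cancel)
    then have "k \<cdot> (inv\<^bsub>SL_inf\<^esub> (g j) \<cdot> g i) = hh i j \<cdot> k"
      using that by (simp add: SLinf.m_assoc)
    then show ?thesis
      using that hh[OF that] column_centralizer_carrier
      by (intro conj_invariant[OF kSU, symmetric]) auto
  qed
  have "(\<Sum>i<N. \<Sum>j<N. c i * cnj (c j) * (shift 0 (hh i j) - shift (0 + 2 * s\<^sup>2) (hh i j))) \<in> \<real>\<^sub>\<le>\<^sub>0" for s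
    unfolding hh_def using h by (intro shift_increment_positive) auto
  moreover have "((\<lambda>s. \<Sum>i<N. \<Sum>j<N. c i * cnj (c j) * (shift 0 (hh i j) - shift (0 + 2 * s\<^sup>2) (hh i j)))
      \<longlongrightarrow> (\<Sum>i<N. \<Sum>j<N. c i * cnj (c j) * (shift 0 (hh i j) - of_real shear_limit))) at_top"
    using hh by (intro tendsto_sum tendsto_mult tendsto_diff tendsto_const) (simp add: shift_tendsto_shear_limit)
  ultimately have "(\<Sum>i<N. \<Sum>j<N. c i * cnj (c j) * (shift 0 (hh i j) - of_real shear_limit)) \<in> \<real>\<^sub>\<le>\<^sub>0"
    by (intro Lim_in_closed_set[OF closed_nonpos_Reals_complex always_eventually]) auto
  also have "(\<Sum>i<N. \<Sum>j<N. c i * cnj (c j) * (shift 0 (hh i j) - of_real shear_limit)) =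
      - (\<Sum>i<N. \<Sum>j<N. c i * cnj (c j) * (of_real shear_limit - \<psi> (inv\<^bsub>SL_inf\<^esub> (g j) \<cdot> g i)))"
    unfolding sum_negf[symmetric] using hh
    by (intro sum.cong refl) (simp add: shift_0 column_centralizer_carrier \<psi>hh algebra_simps)
  finally show "(\<Sum>i<N. \<Sum>j<N. c i * cnj (c j) * (of_real shear_limit - \<psi> (inv\<^bsub>SL_inf\<^esub> (g j) \<cdot> g i))) \<in> \<real>\<^sub>\<ge>\<^sub>0"
    by (simp add: complex_nonpos_Reals_iff complex_nonneg_Reals_iff)
qed

lemma spherical_positive_type_shear_limit: "spherical_positive_type (\<lambda>g. of_real shear_limit - \<psi> g)"
  unfolding spherical_positive_type_def
proof (intro conjI positive_type_shear_limit)
  show "biinvariant SL_inf SU_inf (\<lambda>g. of_real shear_limit - \<psi> g)"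
    using biinvariant by (simp add: biinvariant_def)
  show "continuous_map SL_inf_topology euclidean (\<lambda>g. of_real shear_limit - \<psi> g)"
    by (intro continuous_map_diff continuous continuous_map_canonical_const)
qed

lemma bounded_image: "bounded (\<psi> ` carrier SL_inf)"
proof -
  let ?\<phi> = "\<lambda>g. complex_of_real shear_limit - \<psi> g"
  have *: "2 * Re (?\<phi> \<one>\<^bsub>SL_inf\<^esub>) + 2 * Re (u * ?\<phi> g) \<ge> 0" if g: "g \<in> carrier SL_inf" and u: "u * cnj u = 1" for u g
  proof -
    let ?x = "\<lambda>i::nat. if i = 0 then g else \<one>\<^bsub>SL_inf\<^esub>" and ?c = "\<lambda>i::nat. if i = 0 then u else 1"
    have 2: "{..<2::nat} = {0, 1}" by auto
    have "(\<Sum>i<2. \<Sum>j<2. ?c i * cnj (?c j) * ?\<phi> (inv\<^bsub>SL_inf\<^esub> (?x j) \<cdot> ?x i)) \<in> \<real>\<^sub>\<ge>\<^sub>0"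
      using positive_type_shear_limit g unfolding positive_type_def by simp
    then show ?thesis
      unfolding 2 using g u by (simp add: complex_nonneg_Reals_iff inv_cnj)
  qed
  have "norm (?\<phi> g) \<le> 2 * Re (?\<phi> \<one>\<^bsub>SL_inf\<^esub>)" if "g \<in> carrier SL_inf" for g
    using cmod_le[of "?\<phi> g"] *[OF that, of 1] *[OF that, of "-1"] *[OF that, of "\<i>"] *[OF that, of "-\<i>"] by simp
  then have "norm (\<psi> g) \<le> norm (complex_of_real shear_limit) + 2 * Re (?\<phi> \<one>\<^bsub>SL_inf\<^esub>)" if "g \<in> carrier SL_inf" for g
    using that norm_triangle_ineq4[of "complex_of_real shear_limit" "?\<phi> g"] by fastforce
  then show ?thesis by (auto simp: bounded_iff)
qed

end

lemma spherical_positive_type_cong: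
  assumes "\<And>g. g \<in> carrier SL_inf \<Longrightarrow> \<phi> g = \<phi>' g" "spherical_positive_type \<phi>"
  shows "spherical_positive_type \<phi>'"
  unfolding spherical_positive_type_def
proof (intro conjI)
  show "biinvariant SL_inf SU_inf \<phi>'"
    using assms unfolding spherical_positive_type_def biinvariant_def by (metis SLinf.m_closed SU_inf_carrier)
  show "continuous_map SL_inf_topology euclidean \<phi>'"
    using assms unfolding spherical_positive_type_def
    by (auto intro: continuous_map_eq simp: topspace_SL_inf_topology)
  have "positive_type SL_inf \<phi>" using assms(2) by (simp add: spherical_positive_type_def)
  moreover have "(\<Sum>i<n. \<Sum>j<n. c i * cnj (c j) * \<phi>' (inv\<^bsub>SL_inf\<^esub> (g j) \<cdot> g i)) =
      (\<Sum>i<n. \<Sum>j<n. c i * cnj (c j) * \<phi> (inv\<^bsub>SL_inf\<^esub> (g j) \<cdot> g i))"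
    if "\<forall>i<n. g i \<in> carrier SL_inf" for n :: nat and g c
    using that by (intro sum.cong refl) (simp add: assms(1))
  ultimately show "positive_type SL_inf \<phi>'" unfolding positive_type_def by simp
qed

lemma spherical_positive_type_one:
  assumes "spherical_positive_type \<phi>" shows "\<phi> \<one>\<^bsub>SL_inf\<^esub> \<in> \<real>\<^sub>\<ge>\<^sub>0"
proof -
  have "positive_type SL_inf \<phi>" using assms by (simp add: spherical_positive_type_def)
  from this[unfolded positive_type_def, THEN spec[of _ 1], THEN spec[of _ "\<lambda>_. \<one>\<^bsub>SL_inf\<^esub>"],
      THEN spec[of _ "\<lambda>_. 1"]]
  show ?thesis by simp
qed

lemma sum_diff_const:
  "(\<Sum>i<n. \<Sum>j<n. c i * cnj (c j) * (f i j - complex_of_real a)) =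
   (\<Sum>i<n. \<Sum>j<n. c i * cnj (c j) * f i j) - of_real (a * (cmod (\<Sum>i<n. c i))\<^sup>2)"
proof -
  have "(\<Sum>i<n. \<Sum>j<n. c i * cnj (c j) * complex_of_real a) = of_real a * ((\<Sum>i<n. c i) * cnj (\<Sum>i<n. c i))"
  proof -
    have prod: "(\<Sum>i<n. c i) * cnj (\<Sum>i<n. c i) = (\<Sum>i<n. \<Sum>j<n. c i * cnj (c j))"
      by (simp only: cnj_sum sum_product)
    show ?thesis
      unfolding prod sum_distrib_left by (intro sum.cong refl) (simp add: mult_ac)
  qed
  also have "\<dots> = of_real (a * (cmod (\<Sum>i<n. c i))\<^sup>2)"
    by (simp only: of_real_mult complex_norm_square)
  finally show ?thesis by (simp add: right_diff_distrib sum_subtractf)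
qed

lemma reduced_exists:
  assumes \<phi>: "spherical_positive_type \<phi>"
  obtains a :: real where "spherical_positive_type (\<lambda>g. \<phi> g - of_real a)" "reduced (\<lambda>g. \<phi> g - of_real a)"
proof -
  define A where "A = {a::real. spherical_positive_type (\<lambda>g. \<phi> g - of_real a)}"
  have 0: "0 \<in> A" using \<phi> by (simp add: A_def)
  have "a \<le> Re (\<phi> \<one>\<^bsub>SL_inf\<^esub>)" if "a \<in> A" for a
    using that spherical_positive_type_one by (fastforce simp: A_def complex_nonneg_Reals_iff)
  then have bdd: "bdd_above A" by (auto simp: bdd_above_def)
  have pos: "positive_type SL_inf (\<lambda>g. \<phi> g - of_real (Sup A))"
    unfolding positive_type_def
  proof (intro allI impI)
    fix n :: nat and g :: "nat \<Rightarrow> infmat" and c :: "nat \<Rightarrow> complex"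
    assume g: "\<forall>i<n. g i \<in> carrier SL_inf"
    define X where "X = (\<Sum>i<n. \<Sum>j<n. c i * cnj (c j) * \<phi> (inv\<^bsub>SL_inf\<^esub> (g j) \<cdot> g i))"
    define m where "m = (cmod (\<Sum>i<n. c i))\<^sup>2"
    have X: "X - of_real (a * m) \<in> \<real>\<^sub>\<ge>\<^sub>0" if "a \<in> A" for a
    proof -
      have "(\<Sum>i<n. \<Sum>j<n. c i * cnj (c j) * (\<phi> (inv\<^bsub>SL_inf\<^esub> (g j) \<cdot> g i) - of_real a)) \<in> \<real>\<^sub>\<ge>\<^sub>0"
        using that g unfolding A_def spherical_positive_type_def positive_type_def by blast
      then show ?thesis unfolding sum_diff_const X_def m_def .
    qed
    have "Sup A * m \<le> Re X"
    proof (cases "m = 0")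
      case False
      then have "m > 0" by (simp add: m_def)
      then have "Sup A \<le> Re X / m"
        using 0 X by (intro cSup_least) (auto simp: complex_nonneg_Reals_iff field_simps)
      then show ?thesis using \<open>m > 0\<close> by (simp add: field_simps)
    qed (use X[OF 0] in \<open>simp add: complex_nonneg_Reals_iff\<close>)
    then have "X - of_real (Sup A * m) \<in> \<real>\<^sub>\<ge>\<^sub>0"
      using X[OF 0] by (simp add: complex_nonneg_Reals_iff)
    then show "(\<Sum>i<n. \<Sum>j<n. c i * cnj (c j) * (\<phi> (inv\<^bsub>SL_inf\<^esub> (g j) \<cdot> g i) - of_real (Sup A))) \<in> \<real>\<^sub>\<ge>\<^sub>0"
      unfolding sum_diff_const X_def m_def .
  qed
  have "spherical_positive_type (\<lambda>g. \<phi> g - of_real (Sup A))"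
    using \<phi> pos unfolding spherical_positive_type_def biinvariant_def
    by (auto intro!: continuous_map_diff)
  moreover have "reduced (\<lambda>g. \<phi> g - of_real (Sup A))"
    unfolding reduced_def
  proof (intro allI impI notI)
    fix a :: real assume "a > 0" "spherical_positive_type (\<lambda>g. \<phi> g - of_real (Sup A) - of_real a)"
    then have "Sup A + a \<in> A" by (simp add: A_def diff_diff_eq)
    then show False using cSup_upper[OF _ bdd] \<open>a > 0\<close> by fastforce
  qed
  ultimately show thesis by (rule that)
qed

lemma represents_unique_up_to_constant:
  assumes "represents \<phi> \<psi>" "represents \<phi>' \<psi>"
  shows "\<exists>a::real. \<forall>g\<in>carrier SL_inf. \<phi>' g = \<phi> g + of_real a"
proof (intro exI[of _ "Re (\<phi>' \<one>\<^bsub>SL_inf\<^esub>) - Re (\<phi> \<one>\<^bsub>SL_inf\<^esub>)"] ballI)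
  fix g assume "g \<in> carrier SL_inf"
  then have "\<psi> g = \<psi> \<one>\<^bsub>SL_inf\<^esub> + \<phi> \<one>\<^bsub>SL_inf\<^esub> - \<phi> g"
    "\<psi> g = \<psi> \<one>\<^bsub>SL_inf\<^esub> + \<phi>' \<one>\<^bsub>SL_inf\<^esub> - \<phi>' g"
    using assms unfolding represents_def by blast+
  then have "\<phi>' g = \<phi> g + (\<phi>' \<one>\<^bsub>SL_inf\<^esub> - \<phi> \<one>\<^bsub>SL_inf\<^esub>)"
    by (simp add: complex_eq_iff)
  moreover have "Im (\<phi> \<one>\<^bsub>SL_inf\<^esub>) = 0" "Im (\<phi>' \<one>\<^bsub>SL_inf\<^esub>) = 0"
    using assms[unfolded represents_def, THEN conjunct1, THEN spherical_positive_type_one]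
    by (simp_all add: complex_nonneg_Reals_iff)
  ultimately show "\<phi>' g = \<phi> g + of_real (Re (\<phi>' \<one>\<^bsub>SL_inf\<^esub>) - Re (\<phi> \<one>\<^bsub>SL_inf\<^esub>))"
    by (simp add: complex_eq_iff)
qed

lemma reduced_represents_le:
  assumes "represents \<phi> \<psi>" "reduced \<phi>'" and eq: "\<And>g. g \<in> carrier SL_inf \<Longrightarrow> \<phi>' g = \<phi> g + of_real a"
  shows "a \<le> 0"
proof (rule ccontr)
  assume "\<not> a \<le> 0"
  moreover have "spherical_positive_type (\<lambda>g. \<phi>' g - of_real a)"
    by (rule spherical_positive_type_cong[of \<phi>]) (use assms(1) eq in \<open>auto simp: represents_def\<close>)
  ultimately show False using assms(2) by (simp add: reduced_def)
qed

theorem theorem4p1: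
  fixes \<psi> :: "infmat \<Rightarrow> complex"
  assumes "biinvariant SL_inf SU_inf \<psi>"
    and "continuous_map SL_inf_topology euclidean \<psi>"
    and "negative_type SL_inf \<psi>"
  shows "bounded (\<psi> ` carrier SL_inf)
    \<and> (\<exists>!\<phi>. \<phi> \<in> extensional (carrier SL_inf) \<and> represents \<phi> \<psi> \<and> reduced \<phi>)
    \<and> (\<forall>\<phi> \<phi>'. represents \<phi> \<psi> \<longrightarrow> represents \<phi>' \<psi> \<longrightarrow>
          (\<exists>c::real. \<forall>g\<in>carrier SL_inf. \<phi>' g = \<phi> g + complex_of_real c))"
proof (intro conjI allI impI)
  interpret continuous_spherical_negative_type \<psi>
    using assms by unfold_locales
  show "bounded (\<psi> ` carrier SL_inf)" by (rule bounded_image)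
  show "\<exists>c::real. \<forall>g\<in>carrier SL_inf. \<phi>' g = \<phi> g + complex_of_real c"
    if "represents \<phi> \<psi>" "represents \<phi>' \<psi>" for \<phi> \<phi>'
    using that by (rule represents_unique_up_to_constant)
  obtain a where a: "spherical_positive_type (\<lambda>g. of_real shear_limit - \<psi> g - of_real a)"
      "reduced (\<lambda>g. of_real shear_limit - \<psi> g - of_real a)"
    using spherical_positive_type_shear_limit by (rule reduced_exists)
  define \<phi> where "\<phi> = restrict (\<lambda>g. of_real shear_limit - \<psi> g - of_real a) (carrier SL_inf)"
  have \<phi>: "\<phi> \<in> extensional (carrier SL_inf)" "represents \<phi> \<psi>" "reduced \<phi>"
  proof -
    show "\<phi> \<in> extensional (carrier SL_inf)" by (simp add: \<phi>_def)
    have "spherical_positive_type \<phi>"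
      by (rule spherical_positive_type_cong[OF _ a(1)]) (simp add: \<phi>_def)
    then show "represents \<phi> \<psi>" by (simp add: represents_def \<phi>_def)
    show "reduced \<phi>"
      unfolding reduced_def
    proof (intro allI impI notI)
      fix c :: real assume "c > 0" "spherical_positive_type (\<lambda>g. \<phi> g - of_real c)"
      moreover from this(2) have "spherical_positive_type (\<lambda>g. of_real shear_limit - \<psi> g - of_real a - of_real c)"
        by (rule spherical_positive_type_cong[rotated]) (simp add: \<phi>_def)
      ultimately show False using a(2) by (simp add: reduced_def)
    qed
  qed
  show "\<exists>!\<phi>. \<phi> \<in> extensional (carrier SL_inf) \<and> represents \<phi> \<psi> \<and> reduced \<phi>"
  proof (rule ex1I[of _ \<phi>])
    fix \<phi>' assume \<phi>': "\<phi>' \<in> extensional (carrier SL_inf) \<and> represents \<phi>' \<psi> \<and> reduced \<phi>'"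
    then obtain b :: real where "\<forall>g\<in>carrier SL_inf. \<phi>' g = \<phi> g + of_real b"
      using represents_unique_up_to_constant[OF \<phi>(2), of \<phi>'] by auto
    then have b: "\<phi>' g = \<phi> g + of_real b" if "g \<in> carrier SL_inf" for g using that by blast
    have "b \<le> 0" using \<phi>' by (intro reduced_represents_le[OF \<phi>(2) _ b]) auto
    moreover have "- b \<le> 0" using \<phi>' \<phi>(3) b by (intro reduced_represents_le[of \<phi>' \<psi> \<phi>]) auto
    ultimately have "b = 0" by simp
    then show "\<phi>' = \<phi>" using b \<phi>' \<phi>(1) by (intro extensionalityI[of _ "carrier SL_inf"]) auto
  qed (use \<phi> in blast)
qed

end
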